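(* Let $\nu\ge2$ and $\varepsilon>0$. There is a constant $C=C(\varepsilon,\nu)>0$ depending only on $\varepsilon$ and $\nu$ with the following property. Let $q\in\mathbb{Z}[T_1,\dots,T_\nu]$ be a polynomial of degree $2$ which is irreducible over $\mathbb{Q}$ and whose quadratic part $q_0$ satisfies $\mathrm{rank}(q_0)\ge2$. Then for every $B\ge1$, $$\#\{\mathbf{t}\in\mathbb{Z}^\nu: |\mathbf{t}|\le B,\ q(\mathbf{t})=0\}\le C\,B^{\nu-2+\varepsilon}.$$
   Context: $|\mathbf{t}|=\max_i|t_i|$. The quadratic part $q_0$ of $q$ is its homogeneous component of degree $2$, and $\mathrm{rank}(q_0)$ is the rank of the quadratic form $q_0$. *)

theory Defs
  imports
    "HOL-Analysis.Analysis"
    "HOL-Library.Poly_Mapping"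
    "HOL-Computational_Algebra.Factorial_Ring"
begin

text \<open>
  Polynomials over \<open>'a\<close> in the finitely many variables \<open>'n\<close>: an exponent vector
  \<open>m :: 'n \<Rightarrow>\<^sub>0 nat\<close> stands for the monomial \<open>\<Prod>i. T_i ^ m i\<close>. The ring structure is the
  convolution product of Poly_Mapping.
\<close>

type_synonym ('n, 'a) mpoly = "('n \<Rightarrow>\<^sub>0 nat) \<Rightarrow>\<^sub>0 'a"

definition monom_degree :: "('n::finite \<Rightarrow>\<^sub>0 nat) \<Rightarrow> nat" where
  "monom_degree m = (\<Sum>i\<in>UNIV. Poly_Mapping.lookup m i)"

text \<open>By convention the zero polynomial gets degree 0.\<close>

definition total_degree :: "('n::finite, 'a::zero) mpoly \<Rightarrow> nat" where
  "total_degree p = Max (insert 0 (monom_degree ` Poly_Mapping.keys p))"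

definition eval_mpoly :: "('n::finite, 'a::comm_semiring_1) mpoly \<Rightarrow> 'a ^ 'n \<Rightarrow> 'a" where
  "eval_mpoly p x =
     (\<Sum>m\<in>Poly_Mapping.keys p.
        Poly_Mapping.lookup p m * (\<Prod>i\<in>UNIV. (x $ i) ^ Poly_Mapping.lookup m i))"

definition hom_component :: "nat \<Rightarrow> ('n::finite, 'a::zero) mpoly \<Rightarrow> ('n, 'a) mpoly" where
  "hom_component d p = Poly_Mapping.mapp (\<lambda>m c. if monom_degree m = d then c else 0) p"

abbreviation quadratic_part :: "('n::finite, 'a::zero) mpoly \<Rightarrow> ('n, 'a) mpoly" where
  "quadratic_part p \<equiv> hom_component 2 p"

definition rat_mpoly :: "('n, int) mpoly \<Rightarrow> ('n, rat) mpoly" where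
  "rat_mpoly p = Poly_Mapping.map of_int p"

text \<open>
  The symmetric matrix of a quadratic form: the coefficient of \<open>T_i ^ 2\<close> on the diagonal, and
  half the coefficient of \<open>T_i T_j\<close> off it, so that \<open>f(x) = \<Sum>i j. A_ij x_i x_j\<close>. It carries this
  meaning only for \<open>f\<close> homogeneous of degree 2.
\<close>

definition form_matrix :: "('n::finite, rat) mpoly \<Rightarrow> rat ^ 'n ^ 'n" where
  "form_matrix f =
     (\<chi> i j. if i = j then Poly_Mapping.lookup f (Poly_Mapping.single i 2)
             else Poly_Mapping.lookup f (Poly_Mapping.single i 1 + Poly_Mapping.single j 1) / 2)"

definition form_rank :: "('n::finite, rat) mpoly \<Rightarrow> nat" where
  "form_rank f = rank (form_matrix f)"

definition sup_norm :: "int ^ 'n::finite \<Rightarrow> int" where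
  "sup_norm t = Max (range (\<lambda>i. \<bar>t $ i\<bar>))"

end

theory Submission
  imports Defs
begin

text \<open>
  Choose \<open>u, v\<close> with coordinates in \<open>{0, 1}\<close> on whose span \<open>q\<^sub>0\<close> is nondegenerate. The box is
  covered by \<open>O(B ^ (\<nu> - 2))\<close> planes \<open>s + \<int> u + \<int> v\<close>, on each of which \<open>q\<close> restricts to a
  conic with the same quadratic part, and its determinant is a quadratic polynomial in \<open>s\<close>.

  A conic of nonzero determinant and discriminant has \<open>O(B ^ \<epsilon>)\<close> points uniformly in its
  coefficients: if it has five points, then no three of them are collinear, so they determine
  it and its coefficients may be taken polynomially bounded in \<open>B\<close>. Completing the square
  twice turns it into \<open>Y\<^sup>2 - D X\<^sup>2 = n\<close>. The primitive solutions with a given root of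
  \<open>z\<^sup>2 = D\<close> modulo \<open>n\<close> form one orbit under the \<open>O(log B)\<close> units of bounded size, and there are
  few roots by the divisor bound.

  If the determinant vanishes at \<open>s\<close> and the discriminant is not a square, then there is at
  most one point. If the discriminant is a square, then the determinant does not vanish
  identically, since otherwise \<open>q\<close> would factor; so there are only \<open>O(B ^ (\<nu> - 3))\<close> such
  \<open>s\<close>, each with \<open>O(B)\<close> points.
\<close>

subsection \<open>Pell's equation\<close>

text \<open>What shapes the argument is that no constant may depend on the coefficients of
  \<open>q\<close>. Hence the directions with entries 0 and 1: their 2 by 2 minors are 0, 1 or -1,
  so a nonzero minor is invertible over the integers, and the coordinates of a point of the box
  along \<open>u\<close>, \<open>v\<close> and its offset \<open>s\<close> are bounded by fixed
  multiples of the side length, whatever \<open>q\<close> is. For the same reason units are counted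
  by a gap between successive ones, an argument that needs no fundamental unit and also allows
  \<open>D\<close> to be a square.

  The claim that there are few roots of \<open>z\<^sup>2 = D\<close> modulo \<open>n\<close> is
  false in general: for \<open>D = n = p ^ (2 * k)\<close> there are \<open>p ^ k\<close> of them.
  It holds when no square other than 1 divides both \<open>D\<close> and \<open>n\<close>. Common
  squares can be divided out, because \<open>g\<^sup>2\<close> dividing \<open>D\<close> and
  \<open>n\<close> forces \<open>g\<close> to divide \<open>Y\<close>.

  The symmetric matrix of the quadratic part may have half-integral entries, so the slicing is
  carried out for \<open>2 * q\<close>.\<close>

lemma card_divisors_le:
  fixes n :: nat
  assumes "n > 0"
  shows "card {d. d dvd n} \<le> (\<Prod>p\<in>prime_factors n. multiplicity p n + 1)"
proof -
  let ?F = "\<lambda>d. \<lambda>p\<in>prime_factors n. multiplicity p d"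
  have "inj_on ?F {d. d dvd n}"
  proof (rule inj_onI)
    fix a b assume a: "a \<in> {d. d dvd n}" and b: "b \<in> {d. d dvd n}" and eq: "?F a = ?F b"
    have nz: "a \<noteq> 0" "b \<noteq> 0" using a b assms by auto
    have "multiplicity p a = multiplicity p b" if p: "prime p" for p
    proof (cases "p \<in> prime_factors n")
      case True
      with fun_cong[OF eq, of p] show ?thesis by simp
    next
      case False
      hence "\<not> p dvd n" using p assms by (auto simp: prime_factors_dvd)
      hence "\<not> p dvd a" "\<not> p dvd b" using a b dvd_trans by blast+
      thus ?thesis by (simp add: not_dvd_imp_multiplicity_0)
    qed
    thus "a = b" using nz by (metis multiplicity_eq_nat not_gr_zero)
  qed
  moreover have "?F ` {d. d dvd n} \<subseteq> (\<Pi>\<^sub>E p\<in>prime_factors n. {..multiplicity p n})"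
    using assms by (auto simp: dvd_imp_multiplicity_le)
  moreover have "finite (\<Pi>\<^sub>E p\<in>prime_factors n. {..multiplicity p n})"
    by (intro finite_PiE) auto
  ultimately have "card {d. d dvd n} \<le> card (\<Pi>\<^sub>E p\<in>prime_factors n. {..multiplicity p n})"
    by (rule card_inj_on_le)
  thus ?thesis by (simp add: card_PiE)
qed

text \<open>A prime power \<open>p ^ m\<close> contributes \<open>m + 1\<close> divisors, which is
  at most \<open>p powr (m * \<epsilon>)\<close> once \<open>p \<ge> 2 powr (1/\<epsilon>)\<close>.
  Each of the at most \<open>L\<close> smaller primes costs a further factor
  \<open>K\<close>.\<close>

lemma divisor_bound:
  fixes \<epsilon> :: real
  assumes "\<epsilon> > 0"
  shows "\<exists>C\<ge>1. \<forall>n::nat. n > 0 \<longrightarrow> real (card {d. d dvd n}) \<le> C * real n powr \<epsilon>"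
proof -
  define L where "L = nat \<lceil>2 powr (1/\<epsilon>)\<rceil>"
  \<comment> \<open>\<open>K\<close> is large enough for
    \<open>m + 1 \<le> K * (1 + m * (\<epsilon> * ln 2))\<close>, and the bracket is at most
    \<open>2 powr (m * \<epsilon>)\<close>.\<close>
  define K where "K = 1 + 1 / (\<epsilon> * ln 2)"
  have l2: "\<epsilon> * ln 2 > 0" using assms by simp
  have K1: "K \<ge> 1" using l2 by (simp add: K_def)
  have small: "real m + 1 \<le> K * real p powr (real m * \<epsilon>)" if "p \<ge> 2" for m p :: nat
  proof -
    have "real m + 1 \<le> K * (1 + real m * (\<epsilon> * ln 2))"
      using l2 assms by (simp add: K_def field_simps)
    also have "\<dots> \<le> K * exp (real m * (\<epsilon> * ln 2))"
      using K1 by (intro mult_left_mono) auto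
    also have "exp (real m * (\<epsilon> * ln 2)) = 2 powr (real m * \<epsilon>)" by (simp add: powr_def)
    also have "K * \<dots> \<le> K * real p powr (real m * \<epsilon>)"
      using K1 that assms by (intro mult_left_mono powr_mono2) auto
    finally show ?thesis .
  qed
  have large: "real m + 1 \<le> real p powr (real m * \<epsilon>)" if "p \<ge> L" "p \<ge> 2" for m p :: nat
  proof -
    have "real m + 1 \<le> 2 ^ m" by (induction m) auto
    also have "\<dots> = 2 powr (real m)" by (simp add: powr_realpow)
    also have "\<dots> = (2 powr (1/\<epsilon>)) powr (real m * \<epsilon>)" using assms by (simp add: powr_powr)
    also have "\<dots> \<le> real p powr (real m * \<epsilon>)"
    proof (intro powr_mono2)
      show "2 powr (1/\<epsilon>) \<le> real p" using that unfolding L_def by linarith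
    qed (use assms in auto)
    finally show ?thesis .
  qed
  have "real (card {d. d dvd n}) \<le> K ^ L * real n powr \<epsilon>" if n: "n > 0" for n
  proof -
    let ?P = "prime_factors n" and ?m = "\<lambda>p. multiplicity p n"
    have pp: "p \<ge> 2" if "p \<in> ?P" for p
      using that by (simp add: in_prime_factors_iff prime_ge_2_nat)
    have "real (card {d. d dvd n}) \<le> real (\<Prod>p\<in>?P. ?m p + 1)"
      using card_divisors_le[OF n] by (simp del: of_nat_prod)
    also have "\<dots> = (\<Prod>p\<in>?P. real (?m p) + 1)" by (simp add: add.commute)
    also have "\<dots> \<le> (\<Prod>p\<in>?P. (if p < L then K else 1) * real p powr (real (?m p) * \<epsilon>))"
      using small large pp by (intro prod_mono) auto
    also have "\<dots> = (\<Prod>p\<in>?P. if p < L then K else 1) * (\<Prod>p\<in>?P. real p powr (real (?m p) * \<epsilon>))"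
      by (simp add: prod.distrib)
    also have "(\<Prod>p\<in>?P. real p powr (real (?m p) * \<epsilon>)) = (\<Prod>p\<in>?P. (real p ^ ?m p) powr \<epsilon>)"
    proof (rule prod.cong)
      fix p assume "p \<in> ?P"
      hence "real p > 0" using pp by force
      thus "real p powr (real (?m p) * \<epsilon>) = (real p ^ ?m p) powr \<epsilon>"
        by (simp add: powr_powr flip: powr_realpow)
    qed auto
    also have "\<dots> = (\<Prod>p\<in>?P. real p ^ ?m p) powr \<epsilon>"
      by (rule prod_powr_distrib[symmetric])
    also have "(\<Prod>p\<in>?P. real p ^ ?m p) = real n"
      using n prime_factorization_nat[of n] by (metis (no_types, lifting) of_nat_power of_nat_prod prod.cong)
    also have "(\<Prod>p\<in>?P. if p < L then K else 1) = K ^ card {p\<in>?P. p < L}"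
      by (simp add: prod.If_cases Int_def)
    also have "\<dots> \<le> K ^ L"
    proof -
      have "card {p\<in>?P. p < L} \<le> card {..<L}" by (intro card_mono) auto
      thus ?thesis using K1 by (intro power_increasing) auto
    qed
    finally show ?thesis by (simp add: mult_right_mono)
  qed
  moreover have "K ^ L \<ge> 1" using K1 by (rule one_le_power)
  ultimately show ?thesis by blast
qed

lemma card_le_fibres:
  assumes "finite A" "finite B" "\<And>a. a \<in> A \<Longrightarrow> f a \<in> B"
    and "\<And>b. b \<in> B \<Longrightarrow> card {a \<in> A. f a = b} \<le> k"
  shows "card A \<le> k * card B"
proof -
  have "card A = card (\<Union>b\<in>B. {a \<in> A. f a = b})"
    using assms(3) by (intro arg_cong[where f = card]) auto
  also have "\<dots> \<le> (\<Sum>b\<in>B. card {a \<in> A. f a = b})" by (rule card_UN_le[OF assms(2)])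
  also have "\<dots> \<le> (\<Sum>b\<in>B. k)" using assms(4) by (rule sum_mono)
  finally show ?thesis by (simp add: mult.commute)
qed

section \<open>Units of norm one\<close>

text \<open>Each of the \<open>L\<close> dyadic intervals below \<open>2 ^ L\<close> holds at most
  one element.\<close>

lemma card_doubling_le:
  fixes X :: "int set"
  assumes "X \<subseteq> {1..<2^L}" "\<And>x y. x \<in> X \<Longrightarrow> y \<in> X \<Longrightarrow> x < y \<Longrightarrow> 2 * x \<le> y"
  shows "card X \<le> L"
  using assms
proof (induction L arbitrary: X)
  case (Suc L)
  let ?A = "X \<inter> {1..<2^L}" and ?B = "X \<inter> {2^L..<2^Suc L}"
  have "card ?A \<le> L" using Suc.prems by (intro Suc.IH) auto
  moreover have "card ?B \<le> 1"
  proof (rule card_le_Suc0_iff_eq[THEN iffD2, simplified One_nat_def[symmetric]])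
    have "\<not> x < y" if "x \<in> ?B" "y \<in> ?B" for x y
    proof
      assume "x < y"
      hence "2 * x \<le> y" using that Suc.prems(2) by blast
      thus False using that by simp
    qed
    thus "\<forall>x\<in>?B. \<forall>y\<in>?B. x = y" by (meson linorder_neqE)
  qed auto
  moreover have "X = ?A \<union> ?B" using Suc.prems(1) by auto
  hence "card X \<le> card ?A + card ?B" by (metis card_Un_le)
  ultimately show ?case by linarith
qed simp

text \<open>The quotient \<open>(U' + V' sqrt D) (U - V sqrt D) = W + Z sqrt D\<close> again has
  norm 1. Both components are positive, so \<open>W \<ge> 2\<close>, and multiplying back gives
  \<open>U' = W * U + D * V * Z\<close>.\<close>

lemma pell_unit_gap:
  fixes D U V U' V' :: int
  assumes "D > 0" "U * U - D * V * V = 1" "U' * U' - D * V' * V' = 1"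
    and "U \<ge> 1" "V \<ge> 0" "V' \<ge> 0" "U < U'"
  shows "2 * U \<le> U'"
proof -
  define W Z where "W = U * U' - D * V * V'" and "Z = U * V' - V * U'"
  have norm: "W * W - D * Z * Z = 1"
  proof -
    have "W * W - D * Z * Z = (U * U - D * V * V) * (U' * U' - D * V' * V')"
      unfolding W_def Z_def by algebra
    thus ?thesis using assms by simp
  qed
  have Zpos: "Z > 0"
  proof (rule ccontr)
    assume "\<not> Z > 0"
    hence "U * V' \<le> V * U'" by (simp add: Z_def)
    hence "(U * V') * (U * V') \<le> (V * U') * (V * U')"
      by (rule mult_mono') (use \<open>U * V' \<le> V * U'\<close> assms in auto)
    moreover have "D * ((U * V') * (U * V') - (V * U') * (V * U')) = U' * U' - U * U"
      using assms(2,3) by algebra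
    moreover have "U' * U' > U * U" using assms by (intro mult_strict_mono) auto
    ultimately show False using assms(1)
      by (smt (verit) mult_nonneg_nonpos)
  qed
  have Wpos: "W > 0"
  proof (rule ccontr)
    assume "\<not> W > 0"
    hence "U * U' \<le> D * V * V'" by (simp add: W_def)
    hence "(U * U') * (U * U') \<le> (D * V * V') * (D * V * V')"
      by (rule mult_mono') (use \<open>U * U' \<le> D * V * V'\<close> assms in auto)
    moreover have "(U * U') * (U * U') - (D * V * V') * (D * V * V') = 1 + D * V * V + D * V' * V'"
      using assms(2,3) by algebra
    moreover have "D * V * V \<ge> 0" "D * V' * V' \<ge> 0" using assms by auto
    ultimately show False by linarith
  qed
  have "W \<noteq> 1"
  proof
    assume "W = 1"
    hence "D * Z * Z = 0" using norm by simp
    thus False using Zpos assms(1) by simp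
  qed
  hence "W \<ge> 2" using Wpos by simp
  hence "2 * U \<le> W * U" using assms by (intro mult_right_mono) auto
  also have "\<dots> \<le> W * U + D * V * Z" using assms Zpos by simp
  also have "\<dots> = U'" unfolding W_def Z_def using assms(2) by algebra
  finally show ?thesis .
qed

text \<open>For negative \<open>D\<close> both unknowns lie in \<open>{-1..1}\<close>, whence the 9.
  For positive \<open>D\<close> the first components of the solutions with \<open>U \<ge> 1\<close>
  and \<open>V \<ge> 0\<close> at least double from one to the next, and the signs contribute the
  factor 4.\<close>

lemma pell_units:
  fixes D M :: int
  assumes "D \<noteq> 0" "M < 2 ^ L"
  defines "S \<equiv> {(U, V). U * U - D * V * V = 1 \<and> \<bar>U\<bar> \<le> M}"
  shows "finite S" "card S \<le> 9 + 4 * L"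
proof -
  have "finite S \<and> card S \<le> 9 + 4 * L"
  proof (cases "D > 0")
    case False
    have small: "\<bar>x\<bar> \<le> 1" if "x * x \<le> 1" for x :: int
      using that by (metis abs_square_le_1 power2_eq_square)
    have "S \<subseteq> {-1..1} \<times> {-1..1}"
    proof safe
      fix U V assume "(U, V) \<in> S"
      hence eq: "U * U + (-D) * (V * V) = 1" by (simp add: S_def)
      have "(-D) * (V * V) \<ge> 1 * (V * V)" using False assms(1) by (intro mult_right_mono) auto
      moreover have "U * U \<ge> 0" "V * V \<ge> 0" by auto
      ultimately have "U * U \<le> 1" "V * V \<le> 1" using eq by linarith+
      from this[THEN small] show "U \<in> {-1..1}" "V \<in> {-1..1}" by auto
    qed
    moreover have "card ({-1..1::int} \<times> {-1..1::int}) = 9" by (simp add: card_cartesian_product)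
    ultimately show ?thesis
      using finite_subset[of S "{-1..1} \<times> {-1..1}"] card_mono[of "{-1..1} \<times> {-1..1}" S] by auto
  next
    case True
    define P where "P = {(U, V). U * U - D * V * V = 1 \<and> 1 \<le> U \<and> U \<le> M \<and> 0 \<le> V}"
    have inj: "inj_on fst P"
    proof (rule inj_onI)
      fix p q assume pq: "p \<in> P" "q \<in> P" "fst p = fst q"
      obtain U V V' where e: "p = (U, V)" "q = (U, V')" using pq(3) by (cases p, cases q) auto
      have "D * (V * V) = D * (V' * V')" "V \<ge> 0" "V' \<ge> 0"
        using pq(1,2) e by (auto simp: P_def algebra_simps)
      hence "V * V = V' * V'" using True by simp
      hence "V = V'" using \<open>V \<ge> 0\<close> \<open>V' \<ge> 0\<close> by (auto simp: square_eq_iff)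
      thus "p = q" using e by simp
    qed
    have sub: "fst ` P \<subseteq> {1..M}" by (auto simp: P_def)
    have finP: "finite P" using inj finite_subset[OF sub] finite_imageD by blast
    have "card P = card (fst ` P)" using inj by (simp add: card_image)
    also have "\<dots> \<le> L"
    proof (rule card_doubling_le)
      show "fst ` P \<subseteq> {1..<2^L}" using sub assms(2) by auto
    next
      fix x y assume "x \<in> fst ` P" "y \<in> fst ` P" "x < y"
      thus "2 * x \<le> y" using pell_unit_gap[OF True] unfolding P_def by fastforce
    qed
    finally have cP: "card P \<le> L" .
    let ?f = "\<lambda>(s, t, U, V). (s * U, t * V) :: int \<times> int"
    let ?A = "{-1, 1::int} \<times> {-1, 1::int} \<times> P"
    have "S \<subseteq> ?f ` ?A"
    proof safe
      fix U V assume "(U, V) \<in> S"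
      hence eq: "U * U - D * V * V = 1" "\<bar>U\<bar> \<le> M" by (auto simp: S_def)
      have "U \<noteq> 0"
      proof
        assume "U = 0"
        hence "D * (V * V) = -1" using eq(1) by (simp add: mult.assoc)
        moreover have "D * (V * V) \<ge> 0" using True by simp
        ultimately show False by linarith
      qed
      have abs: "\<bar>U\<bar> * \<bar>U\<bar> - D * \<bar>V\<bar> * \<bar>V\<bar> = 1" using eq(1) by (simp add: mult.assoc)
      define s t where "s = (if U \<ge> 0 then 1 else - 1::int)" and "t = (if V \<ge> 0 then 1 else - 1::int)"
      have "(s, t, \<bar>U\<bar>, \<bar>V\<bar>) \<in> ?A" using abs eq(2) \<open>U \<noteq> 0\<close> by (auto simp: P_def s_def t_def)
      moreover have "?f (s, t, \<bar>U\<bar>, \<bar>V\<bar>) = (U, V)" by (simp add: s_def t_def)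
      ultimately show "(U, V) \<in> ?f ` ?A" by (rule rev_image_eqI[OF _ sym])
    qed
    moreover have "finite ?A" using finP by simp
    moreover have "card ?A = 4 * card P" by (simp add: card_cartesian_product)
    ultimately have "finite S" "card S \<le> 4 * card P"
      by (auto intro: finite_surj) (metis surj_card_le)
    thus ?thesis using cP by auto
  qed
  thus "finite S" "card S \<le> 9 + 4 * L" by auto
qed

text \<open>
  Two square roots of \<open>D\<close> modulo \<open>n\<close> with the same \<open>gcd (z - w) n\<close> agree modulo \<open>n / 2\<close>,
  since \<open>n\<close> divides \<open>(z - w) (z + w)\<close> and the two cofactors of \<open>n\<close> have greatest common
  divisor at most 2.
\<close>

lemma sqrt_mod_card:
  fixes D n :: int
  assumes n: "n > 0" and nosq: "\<And>g. g * g dvd D \<Longrightarrow> g * g dvd n \<Longrightarrow> \<bar>g\<bar> = 1"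
  shows "card {z \<in> {0..<n}. n dvd z * z - D} \<le> 3 * card {d. d dvd nat n}"
proof (cases "{z \<in> {0..<n}. n dvd z * z - D} = {}")
  case False
  define Z where "Z = {z \<in> {0..<n}. n dvd z * z - D}"
  obtain w where w: "w \<in> Z" using False by (auto simp: Z_def)
  have close: "n dvd 2 * (z - z')" if z: "z \<in> Z" "z' \<in> Z" and eq: "gcd (z - w) n = gcd (z' - w) n" for z z'
  proof -
    define d where "d = gcd (z - w) n"
    define c where "c = n div d"
    have dn: "d dvd n" by (simp add: d_def)
    have d0: "d \<noteq> 0" using n by (simp add: d_def)
    have ndc: "n = d * c" using dn by (simp add: c_def)
    have sum: "c dvd y + w" if y: "y \<in> Z" "gcd (y - w) n = d" for y
    proof -
      have "n dvd (y * y - D) - (w * w - D)"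
        by (rule dvd_diff) (use y(1) w in \<open>auto simp: Z_def\<close>)
      also have "(y * y - D) - (w * w - D) = (y - w) * (y + w)" by algebra
      also have "y - w = d * ((y - w) div d)" using y(2) by auto
      finally have "d * c dvd d * ((y - w) div d * (y + w))" unfolding ndc by (simp only: mult.assoc)
      hence "c dvd (y - w) div d * (y + w)" using d0 by (simp only: dvd_mult_cancel_left) simp
      moreover have "coprime ((y - w) div d) c"
        unfolding c_def using div_gcd_coprime[of "y - w" n] y(2) n by auto
      ultimately show ?thesis by (simp add: coprime_commute coprime_dvd_mult_right_iff)
    qed
    have "c dvd (z + w) - (z' + w)" using sum z eq by (intro dvd_diff) (auto simp: d_def)
    hence cz: "c dvd z - z'" by simp
    have "d dvd (z - w) - (z' - w)"
      by (rule dvd_diff) (simp add: d_def, simp add: d_def eq)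
    hence dz: "d dvd z - z'" by simp
    \<comment> \<open>Why \<open>e\<close> is at most 2: it divides \<open>z + w\<close> and
      \<open>z - w\<close>, hence \<open>2 * w\<close>. As \<open>e * e\<close> divides
      \<open>n\<close>, which divides \<open>w * w - D\<close>, it also divides
      \<open>4 * D\<close>. So \<open>nosq\<close> applies to \<open>e\<close> itself if
      \<open>e\<close> is odd and to its half if \<open>e\<close> is even.\<close>
    define e where "e = gcd d c"
    have een: "e * e dvd n" unfolding ndc e_def by (intro mult_dvd_mono) auto
    have "e dvd z + w" using sum[OF z(1)] by (auto simp: e_def d_def intro: dvd_trans)
    moreover have "e dvd z - w" by (auto simp: e_def d_def intro: dvd_trans)
    ultimately have "e dvd (z + w) - (z - w)" by (rule dvd_diff)
    hence "e dvd 2 * w" by (simp add: algebra_simps)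
    hence "e * e dvd (2 * w) * (2 * w)" by (intro mult_dvd_mono)
    moreover have "e * e dvd 4 * (w * w - D)" using een w dvd_trans unfolding Z_def by (blast intro: dvd_mult)
    ultimately have "e * e dvd (2 * w) * (2 * w) - 4 * (w * w - D)" by (rule dvd_diff)
    hence ee4: "e * e dvd 4 * D" by (simp add: algebra_simps)
    have "e dvd 2"
    proof (cases "even e")
      case True
      then obtain f where f: "e = 2 * f" by blast
      have "4 * (f * f) dvd 4 * D" using ee4 f by (simp add: algebra_simps)
      hence "f * f dvd D" by simp
      moreover have "f * f dvd n" using een f by (metis dvd_mult_left mult.assoc mult.commute)
      ultimately have "\<bar>f\<bar> = 1" by (rule nosq)
      thus ?thesis using f by auto
    next
      case False
      hence "coprime e 2" by (simp add: coprime_right_2_iff_odd)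
      hence cop: "coprime (e * e) (2 * 2)" by (simp only: coprime_mult_left_iff coprime_mult_right_iff simp_thms)
      have "e * e dvd (2 * 2) * D" using ee4 by simp
      hence "e * e dvd D" by (simp only: coprime_dvd_mult_right_iff[OF cop])
      hence "\<bar>e\<bar> = 1" using een nosq by blast
      thus ?thesis by (metis abs_dvd_iff one_dvd)
    qed
    have "n dvd e * lcm d c"
      unfolding e_def by (metis abs_mult dvd_abs_iff dvd_refl ndc prod_gcd_lcm_int)
    also have "e * lcm d c dvd 2 * (z - z')"
      using \<open>e dvd 2\<close> cz dz by (intro mult_dvd_mono lcm_least)
    finally show ?thesis .
  qed
  have "card Z \<le> 3 * card {d. d dvd nat n}"
  proof (rule card_le_fibres[where f = "\<lambda>z. nat (gcd (z - w) n)"])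
    show "finite Z" by (rule finite_subset[of _ "{0..<n}"]) (auto simp: Z_def)
    show "finite {d. d dvd nat n}" using n by simp
    show "nat (gcd (z - w) n) \<in> {d. d dvd nat n}" for z
      using n by (simp add: nat_dvd_iff)
    fix b
    show "card {z \<in> Z. nat (gcd (z - w) n) = b} \<le> 3"
    proof (cases "{z \<in> Z. nat (gcd (z - w) n) = b} = {}")
      case True thus ?thesis by (metis card.empty zero_le)
    next
      case False
      then obtain y where y: "y \<in> Z" "nat (gcd (y - w) n) = b" by blast
      \<comment> \<open>Residues in \<open>{0..<n}\<close> that agree modulo \<open>n / 2\<close>
        differ by 0 or by half of \<open>n\<close>. For odd \<open>n\<close> only
        \<open>k = 0\<close> can occur below, so the rounding is harmless.\<close>
      let ?h = "n div 2"
      have "{z \<in> Z. nat (gcd (z - w) n) = b} \<subseteq> {y, y + ?h, y - ?h}"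
      proof
        fix z assume "z \<in> {z \<in> Z. nat (gcd (z - w) n) = b}"
        hence z: "z \<in> Z" "nat (gcd (z - w) n) = b" by auto
        have "gcd (z - w) n = gcd (y - w) n" using y(2) z(2) by (metis eq_nat_nat_iff gcd_ge_0_int)
        hence "n dvd 2 * (z - y)" using y(1) z(1) by (intro close)
        then obtain k where k: "2 * (z - y) = n * k" by blast
        have "\<bar>z - y\<bar> < n" using z(1) y(1) by (auto simp: Z_def)
        hence "\<bar>2 * (z - y)\<bar> < n * 2" unfolding abs_mult by simp
        hence "\<bar>k\<bar> < 2" unfolding k using n by (simp add: abs_mult)
        hence "k = 0 \<or> k = 1 \<or> k = -1" by linarith
        thus "z \<in> {y, y + ?h, y - ?h}" using k by auto
      qed
      hence "card {z \<in> Z. nat (gcd (z - w) n) = b} \<le> card {y, y + ?h, y - ?h}"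
        by (intro card_mono) auto
      also have "\<dots> \<le> 3" by (simp add: card_insert_if)
      finally show ?thesis .
    qed
  qed
  thus ?thesis by (simp add: Z_def)
next
  case True
  thus ?thesis by (metis card.empty zero_le)
qed

section \<open>Counting solutions of the Pell equation\<close>

lemma abs_le_abs_mult: "k \<noteq> 0 \<Longrightarrow> \<bar>y\<bar> \<le> \<bar>k * y\<bar>" for k y :: int
  using mult_right_mono[of 1 "\<bar>k\<bar>" "\<bar>y\<bar>"] by (simp add: abs_mult)

text \<open>\<open>X\<close> is invertible modulo \<open>n\<close>, so a solution has a residue
  \<open>z = Y / X\<close>, a square root of \<open>D\<close> modulo \<open>n\<close>. If two
  solutions share it, then the quotient of \<open>Y + X sqrt D\<close> by
  \<open>Y0 + X0 sqrt D\<close> has integral components and norm 1. With \<open>(Y0, X0)\<close>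
  fixed, this unit determines \<open>(Y, X)\<close>, and \<open>R\<close> counts the
  residues.\<close>

lemma pell_primitive_no_common_square:
  fixes D n M :: int
  assumes "n \<noteq> 0" and nosq: "\<And>g. g * g dvd D \<Longrightarrow> g * g dvd n \<Longrightarrow> \<bar>g\<bar> = 1"
    and units: "finite {(U, V). U * U - D * V * V = 1 \<and> \<bar>U\<bar> \<le> (1 + \<bar>D\<bar>) * (M * M)}"
      "card {(U, V). U * U - D * V * V = 1 \<and> \<bar>U\<bar> \<le> (1 + \<bar>D\<bar>) * (M * M)} \<le> u"
  shows "card {(Y, X). Y * Y - D * X * X = n \<and> coprime Y X \<and> \<bar>Y\<bar> \<le> M \<and> \<bar>X\<bar> \<le> M}
           \<le> 3 * card {d. d dvd nat \<bar>n\<bar>} * u"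
proof -
  define S where "S = {(Y, X). Y * Y - D * X * X = n \<and> coprime Y X \<and> \<bar>Y\<bar> \<le> M \<and> \<bar>X\<bar> \<le> M}"
  define Q where "Q = {(U, V). U * U - D * V * V = 1 \<and> \<bar>U\<bar> \<le> (1 + \<bar>D\<bar>) * (M * M)}"
  define R where "R = {z \<in> {0..<\<bar>n\<bar>}. \<bar>n\<bar> dvd z * z - D}"
  have cop: "coprime X n" if "(Y, X) \<in> S" for Y X
  proof -
    have "coprime (Y * Y) X" "n + D * X * X = Y * Y" using that by (auto simp: S_def)
    moreover have "c dvd n + D * X * X" if "c dvd X" "c dvd n" for c using that by simp
    ultimately show ?thesis by (metis coprime_common_divisor coprimeI)
  qed
  have ex: "\<exists>z. z \<in> {0..<\<bar>n\<bar>} \<and> n dvd z * snd p - fst p" if p: "p \<in> S" for p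
  proof -
    obtain Y X where e: "p = (Y, X)" by (cases p)
    obtain a b where ab: "a * X + b * n = 1"
      using bezout_int[of X n] cop p e by (metis coprime_iff_gcd_eq_1)
    have "n dvd (Y * a) mod \<bar>n\<bar> - Y * a"
      by (metis abs_dvd_iff dvd_minus_mod dvd_diff_commute)
    hence "n dvd ((Y * a) mod \<bar>n\<bar> - Y * a) * X - n * (b * Y)" by simp
    also have "\<dots> = ((Y * a) mod \<bar>n\<bar>) * X - Y * (a * X + b * n)" by algebra
    finally have "n dvd ((Y * a) mod \<bar>n\<bar>) * snd p - fst p" using ab e by simp
    thus ?thesis using assms(1) by (intro exI[of _ "(Y * a) mod \<bar>n\<bar>"]) simp
  qed
  define z where "z = (\<lambda>p. SOME z. z \<in> {0..<\<bar>n\<bar>} \<and> n dvd z * snd p - fst p)"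
  have z: "z p \<in> {0..<\<bar>n\<bar>}" "n dvd z p * snd p - fst p" if "p \<in> S" for p
    using someI_ex[OF ex[OF that]] unfolding z_def by blast+
  have zR: "z p \<in> R" if p: "p \<in> S" for p
  proof -
    obtain Y X where e: "p = (Y, X)" by (cases p)
    have "n dvd (z p * X - Y) * (z p * X + Y) + n"
      using z(2)[OF p] e by simp
    also have "(z p * X - Y) * (z p * X + Y) + n = (X * X) * (z p * z p - D)"
      using p e unfolding S_def by (auto simp: algebra_simps)
    finally have "n dvd z p * z p - D"
      using cop p e by (metis coprime_commute coprime_dvd_mult_right_iff mult.assoc)
    thus ?thesis using z(1)[OF p] by (simp add: R_def)
  qed
  have "finite S"
  proof (rule finite_subset)
    show "S \<subseteq> {-M..M} \<times> {-M..M}" by (auto simp: S_def)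
  qed simp
  have "card S \<le> u * card R"
  proof (rule card_le_fibres[where f = z])
    show "finite S" by fact
    show "finite R" by (rule finite_subset[of _ "{0..<\<bar>n\<bar>}"]) (auto simp: R_def)
    show "z p \<in> R" if "p \<in> S" for p using zR that .
    fix r
    show "card {p \<in> S. z p = r} \<le> u"
    proof (cases "{p \<in> S. z p = r} = {}")
      case True thus ?thesis by (metis card.empty zero_le)
    next
      case False
      then obtain Y0 X0 where p0: "(Y0, X0) \<in> S" "z (Y0, X0) = r" by auto
      \<comment> \<open>The components of \<open>(Y + X sqrt D) (Y0 - X0 sqrt D) / n\<close>, the
        second with reversed sign. Both divisions are exact since \<open>Y = r * X\<close>,
        \<open>Y0 = r * X0\<close> and \<open>r * r = D\<close> modulo \<open>n\<close>.\<close>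
      define f where "f = (\<lambda>(Y, X). ((Y * Y0 - D * X * X0) div n, (Y * X0 - X * Y0) div n))"
      have dv: "n dvd Y * Y0 - D * X * X0" "n dvd Y * X0 - X * Y0"
        if "(Y, X) \<in> S" "z (Y, X) = r" for Y X
      proof -
        have a: "n dvd r * X - Y" "n dvd r * X0 - Y0" using z(2) that p0 by force+
        have b: "n dvd r * r - D" using zR[OF p0(1)] p0(2) by (simp add: R_def)
        have "Y * X0 - X * Y0 = X * (r * X0 - Y0) - X0 * (r * X - Y)" by algebra
        thus "n dvd Y * X0 - X * Y0" using a by simp
        have "Y * Y0 - D * X * X0 = X * X0 * (r * r - D) - r * X * (r * X0 - Y0) - Y0 * (r * X - Y)"
          by algebra
        thus "n dvd Y * Y0 - D * X * X0" using a b by simp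
      qed
      have unit: "f p \<in> Q" and fp: "\<exists>U V. f p = (U, V) \<and> fst p = Y0 * U - D * X0 * V \<and> snd p = X0 * U - Y0 * V"
        if p: "p \<in> S" "z p = r" for p
      proof -
        obtain Y X where e: "p = (Y, X)" by (cases p)
        obtain U V where UV: "Y * Y0 - D * X * X0 = n * U" "Y * X0 - X * Y0 = n * V"
          using dv p e by (metis dvd_def)
        have fe: "f p = (U, V)" using UV assms(1) by (simp add: f_def e)
        have nn: "Y * Y - D * X * X = n" "Y0 * Y0 - D * X0 * X0 = n"
          using p(1) e p0 by (auto simp: S_def)
        have "n * n * (U * U - D * V * V) = (n * U) * (n * U) - D * (n * V) * (n * V)" by algebra
        also have "\<dots> = (Y * Y - D * X * X) * (Y0 * Y0 - D * X0 * X0)"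
          unfolding UV[symmetric] by algebra
        finally have norm: "U * U - D * V * V = 1" using nn assms(1) by simp
        have bd: "\<bar>Y\<bar> \<le> M" "\<bar>X\<bar> \<le> M" "\<bar>Y0\<bar> \<le> M" "\<bar>X0\<bar> \<le> M" using p(1) e p0 by (auto simp: S_def)
        have "\<bar>U\<bar> \<le> \<bar>n * U\<bar>" using assms(1) by (rule abs_le_abs_mult)
        also have "\<dots> \<le> \<bar>Y * Y0\<bar> + \<bar>D\<bar> * \<bar>X * X0\<bar>"
          unfolding UV(1)[symmetric] by (metis abs_mult abs_triangle_ineq4 mult.assoc)
        also have "\<dots> \<le> M * M + \<bar>D\<bar> * (M * M)"
          unfolding abs_mult using bd by (intro add_mono mult_left_mono mult_mono) auto
        finally have "\<bar>U\<bar> \<le> (1 + \<bar>D\<bar>) * (M * M)" by (simp add: algebra_simps)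
        thus "f p \<in> Q" using norm fe by (simp add: Q_def)
        have "n * (Y0 * U - D * X0 * V) = Y0 * (n * U) - D * X0 * (n * V)" by algebra
        also have "\<dots> = (Y0 * Y0 - D * X0 * X0) * Y" unfolding UV[symmetric] by algebra
        finally have Y: "Y0 * U - D * X0 * V = Y" using nn assms(1) by simp
        have "n * (X0 * U - Y0 * V) = X0 * (n * U) - Y0 * (n * V)" by algebra
        also have "\<dots> = (Y0 * Y0 - D * X0 * X0) * X" unfolding UV[symmetric] by algebra
        finally have X: "X0 * U - Y0 * V = X" using nn assms(1) by simp
        show "\<exists>U V. f p = (U, V) \<and> fst p = Y0 * U - D * X0 * V \<and> snd p = X0 * U - Y0 * V"
          using fe X Y e by simp
      qed
      have "inj_on f {p \<in> S. z p = r}"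
      proof (rule inj_onI)
        fix p q assume "p \<in> {p \<in> S. z p = r}" "q \<in> {p \<in> S. z p = r}" "f p = f q"
        thus "p = q" using fp[of p] fp[of q] by (auto simp: prod_eq_iff)
      qed
      hence "card {p \<in> S. z p = r} \<le> card Q"
        using unit units(1)[folded Q_def] by (intro card_inj_on_le[of f]) auto
      thus ?thesis using units(2) by (simp add: Q_def)
    qed
  qed
  also have "card R \<le> 3 * card {d. d dvd nat \<bar>n\<bar>}"
    unfolding R_def using assms(1) nosq by (intro sqrt_mod_card) auto
  finally show ?thesis by (simp add: S_def mult.commute)
qed

text \<open>Strong induction on the size of \<open>n\<close>. If \<open>g * g\<close> divides
  \<open>D\<close> and \<open>n\<close>, then \<open>g\<close> divides \<open>Y\<close>, and
  \<open>(Y div g, X)\<close> solves the equation with \<open>D\<close> and \<open>n\<close> divided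
  by \<open>g * g\<close>; it stays coprime and in the box. Since \<open>D\<close> changes on the
  way, \<open>units\<close> is assumed for all \<open>D\<close> up to \<open>T\<close> at
  once.\<close>

lemma pell_primitive:
  fixes D n M T :: int
  assumes "n \<noteq> 0" "D \<noteq> 0" "\<bar>D\<bar> \<le> T" "M \<ge> 0"
    and units: "\<And>D. D \<noteq> 0 \<Longrightarrow> \<bar>D\<bar> \<le> T \<Longrightarrow> finite {(U, V). U * U - D * V * V = 1 \<and> \<bar>U\<bar> \<le> (1 + T) * (M * M)} \<and>
      card {(U, V). U * U - D * V * V = 1 \<and> \<bar>U\<bar> \<le> (1 + T) * (M * M)} \<le> u"
  shows "card {(Y, X). Y * Y - D * X * X = n \<and> coprime Y X \<and> \<bar>Y\<bar> \<le> M \<and> \<bar>X\<bar> \<le> M}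
           \<le> 3 * card {d. d dvd nat \<bar>n\<bar>} * u"
  using assms(1-3)
proof (induction "nat \<bar>n\<bar>" arbitrary: n D rule: less_induct)
  case less
  show ?case
  proof (cases "\<exists>g. g * g dvd D \<and> g * g dvd n \<and> \<bar>g\<bar> \<noteq> 1")
    case False
    have sub: "{(U, V). U * U - D * V * V = 1 \<and> \<bar>U\<bar> \<le> (1 + \<bar>D\<bar>) * (M * M)}
        \<subseteq> {(U, V). U * U - D * V * V = 1 \<and> \<bar>U\<bar> \<le> (1 + T) * (M * M)}"
      using mult_right_mono[of "1 + \<bar>D\<bar>" "1 + T" "M * M"] less.prems(3) by auto
    show ?thesis
    proof (rule pell_primitive_no_common_square)
      show "finite {(U, V). U * U - D * V * V = 1 \<and> \<bar>U\<bar> \<le> (1 + \<bar>D\<bar>) * (M * M)}"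
        using finite_subset[OF sub] units less.prems by blast
      show "card {(U, V). U * U - D * V * V = 1 \<and> \<bar>U\<bar> \<le> (1 + \<bar>D\<bar>) * (M * M)} \<le> u"
        using card_mono[OF _ sub] units[OF less.prems(2,3)] by linarith
    qed (use less.prems False in blast)+
  next
    case True
    then obtain g D' n' where g: "D = g * g * D'" "n = g * g * n'" "\<bar>g\<bar> \<noteq> 1" by (auto simp: dvd_def)
    have nz: "g \<noteq> 0" "n' \<noteq> 0" "D' \<noteq> 0" using g less.prems by auto
    have "2 \<le> \<bar>g\<bar>" using nz(1) g(3) by linarith
    hence "2 * 2 \<le> \<bar>g\<bar> * \<bar>g\<bar>" by (intro mult_mono) auto
    hence g1: "\<bar>g * g\<bar> > 1" by (simp add: abs_mult)
    define S where "S = {(Y, X). Y * Y - D * X * X = n \<and> coprime Y X \<and> \<bar>Y\<bar> \<le> M \<and> \<bar>X\<bar> \<le> M}"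
    define S' where "S' = {(Y, X). Y * Y - D' * X * X = n' \<and> coprime Y X \<and> \<bar>Y\<bar> \<le> M \<and> \<bar>X\<bar> \<le> M}"
    have gY: "g dvd fst p" if p: "p \<in> S" for p
    proof -
      obtain Y X where e: "p = (Y, X)" by (cases p)
      have "Y * Y = g * g * (D' * X * X + n')" using p e g by (auto simp: S_def algebra_simps)
      hence "g ^ 2 dvd Y ^ 2" by (simp add: power2_eq_square)
      thus ?thesis using e by simp
    qed
    let ?f = "\<lambda>p. (fst p div g, snd p)"
    have "inj_on ?f S" by (rule inj_onI) (use gY in \<open>auto simp: prod_eq_iff dvd_div_eq_iff\<close>)
    moreover have "?f ` S \<subseteq> S'"
    proof safe
      fix Y X assume p: "(Y, X) \<in> S"
      then obtain Y' where Y': "Y = g * Y'" using gY by force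
      have "g * g * (Y' * Y' - D' * X * X) = g * g * n'"
        using p g Y' by (auto simp: S_def algebra_simps)
      hence "Y' * Y' - D' * X * X = n'" using nz by simp
      moreover have "coprime Y' X" using p Y' by (simp add: S_def)
      moreover have "\<bar>Y'\<bar> \<le> \<bar>Y\<bar>" unfolding Y' by (rule abs_le_abs_mult[OF nz(1)])
      hence "\<bar>Y'\<bar> \<le> M" using p by (auto simp: S_def)
      ultimately show "?f (Y, X) \<in> S'" using p Y' nz by (simp add: S'_def S_def)
    qed
    moreover have "finite S'"
      by (rule finite_subset[of _ "{-M..M} \<times> {-M..M}"]) (auto simp: S'_def)
    ultimately have "card S \<le> card S'" by (rule card_inj_on_le)
    also have "card S' \<le> 3 * card {d. d dvd nat \<bar>n'\<bar>} * u" unfolding S'_def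
    proof (rule less.hyps)
      have "1 * \<bar>n'\<bar> < \<bar>g * g\<bar> * \<bar>n'\<bar>" using nz g1 by (intro mult_strict_right_mono) auto
      thus "nat \<bar>n'\<bar> < nat \<bar>n\<bar>" using g by (simp add: abs_mult)
      have "1 * \<bar>D'\<bar> \<le> \<bar>g * g\<bar> * \<bar>D'\<bar>" using g1 by (intro mult_right_mono) auto
      also have "\<dots> = \<bar>D\<bar>" using g(1) by (simp add: abs_mult)
      finally show "\<bar>D'\<bar> \<le> T" using less.prems by simp
    qed (use nz in auto)
    also have "card {d. d dvd nat \<bar>n'\<bar>} \<le> card {d. d dvd nat \<bar>n\<bar>}"
    proof (rule card_mono)
      show "finite {d. d dvd nat \<bar>n\<bar>}" using less.prems by (intro finite_divisors_nat) simp
      show "{d. d dvd nat \<bar>n'\<bar>} \<subseteq> {d. d dvd nat \<bar>n\<bar>}"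
        using g(2) by (auto simp: abs_mult nat_mult_distrib)
    qed
    finally show ?thesis by (simp add: S_def)
  qed
qed

text \<open>The solutions are sorted by \<open>k = gcd Y X\<close>. As \<open>k * k\<close> divides
  \<open>n\<close>, there are at most \<open>t\<close> values of \<open>k\<close>, and division by
  \<open>k\<close> leads to primitive solutions for \<open>n / k\<^sup>2\<close>.\<close>

lemma pell_count:
  fixes D n M T :: int
  assumes "n \<noteq> 0" "D \<noteq> 0" "\<bar>D\<bar> \<le> T" "\<bar>n\<bar> \<le> T" "M \<ge> 0"
    and units: "\<And>D. D \<noteq> 0 \<Longrightarrow> \<bar>D\<bar> \<le> T \<Longrightarrow> finite {(U, V). U * U - D * V * V = 1 \<and> \<bar>U\<bar> \<le> (1 + T) * (M * M)} \<and>
      card {(U, V). U * U - D * V * V = 1 \<and> \<bar>U\<bar> \<le> (1 + T) * (M * M)} \<le> u"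
    and divs: "\<And>m. m > 0 \<Longrightarrow> int m \<le> T \<Longrightarrow> card {d. d dvd m} \<le> t"
  shows "card {(Y, X). Y * Y - D * X * X = n \<and> \<bar>Y\<bar> \<le> M \<and> \<bar>X\<bar> \<le> M} \<le> 3 * t * u * t"
proof -
  define S where "S = {(Y, X). Y * Y - D * X * X = n \<and> \<bar>Y\<bar> \<le> M \<and> \<bar>X\<bar> \<le> M}"
  have finS: "finite S"
    by (rule finite_subset[of _ "{-M..M} \<times> {-M..M}"]) (auto simp: S_def)
  define f where "f = (\<lambda>p. nat (gcd (fst p) (snd p)) :: nat)"
  have sq: "int (f p) * int (f p) dvd n" if "p \<in> S" for p
  proof -
    obtain Y X where e: "p = (Y, X)" by (cases p)
    have "int (f p) * int (f p) dvd Y * Y - D * (X * X)"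
      unfolding f_def e by (intro dvd_diff mult_dvd_mono dvd_mult) auto
    thus ?thesis using that e by (simp add: S_def mult.assoc)
  qed
  have "card S \<le> 3 * t * u * card {d. d dvd nat \<bar>n\<bar>}"
  proof (rule card_le_fibres[where f = f])
    show "finite S" by fact
    show "finite {d. d dvd nat \<bar>n\<bar>}" using assms(1) by (intro finite_divisors_nat) simp
    show "f p \<in> {d. d dvd nat \<bar>n\<bar>}" if "p \<in> S" for p
      using dvd_mult_left[OF sq[OF that]] by (simp add: int_dvd_int_iff[symmetric])
    fix k
    show "card {p \<in> S. f p = k} \<le> 3 * t * u"
    proof (cases "{p \<in> S. f p = k} = {}")
      case True thus ?thesis by (metis card.empty zero_le)
    next
      case False
      then obtain p where "p \<in> S" "f p = k" by blast
      then obtain n' where n': "n = int k * int k * n'" using sq unfolding dvd_def by blast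
      have nz: "k \<noteq> 0" "n' \<noteq> 0" using n' assms(1) by auto
      define S' where "S' = {(Y, X). Y * Y - D * X * X = n' \<and> coprime Y X \<and> \<bar>Y\<bar> \<le> M \<and> \<bar>X\<bar> \<le> M}"
      let ?h = "\<lambda>p. (fst p div int k, snd p div int k)"
      have dv: "int k dvd fst p" "int k dvd snd p" if "p \<in> {p \<in> S. f p = k}" for p
        using that by (auto simp: f_def)
      have "inj_on ?h {p \<in> S. f p = k}"
        by (rule inj_onI) (use dv in \<open>auto simp: prod_eq_iff dvd_div_eq_iff\<close>)
      moreover have "?h ` {p \<in> S. f p = k} \<subseteq> S'"
      proof
        fix q assume "q \<in> ?h ` {p \<in> S. f p = k}"
        then obtain p where p: "p \<in> S" "f p = k" "q = ?h p" by blast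
        then obtain Y X where YX: "fst p = int k * Y" "snd p = int k * X" using dv[of p] by (auto simp: dvd_def)
        have q: "q = (Y, X)" using p(3) YX nz by simp
        have "int k * int k * (Y * Y - D * X * X) = int k * int k * n'"
          using p(1) YX n' by (auto simp: S_def algebra_simps)
        hence 1: "Y * Y - D * X * X = n'" using nz by simp
        have "int k = gcd (int k * Y) (int k * X)" using p(2) YX unfolding f_def by (metis gcd_ge_0_int int_nat_eq)
        also have "\<dots> = int k * gcd Y X" by (simp add: gcd_mult_left)
        finally have "gcd Y X = 1" using nz by simp
        moreover have "\<bar>Y\<bar> \<le> \<bar>int k * Y\<bar>" "\<bar>X\<bar> \<le> \<bar>int k * X\<bar>" using nz by (simp_all add: abs_le_abs_mult del: abs_mult)
        hence "\<bar>Y\<bar> \<le> M" "\<bar>X\<bar> \<le> M" using p(1) YX by (auto simp: S_def)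
        ultimately show "q \<in> S'" using 1 q by (simp add: S'_def coprime_iff_gcd_eq_1)
      qed
      moreover have "finite S'"
        by (rule finite_subset[of _ "{-M..M} \<times> {-M..M}"]) (auto simp: S'_def)
      ultimately have "card {p \<in> S. f p = k} \<le> card S'" by (rule card_inj_on_le)
      also have "\<dots> \<le> 3 * card {d. d dvd nat \<bar>n'\<bar>} * u"
        unfolding S'_def by (rule pell_primitive[where T = T]) (use nz assms(2,3,5) units in auto)
      also have "card {d. d dvd nat \<bar>n'\<bar>} \<le> t"
      proof (rule divs)
        show "int (nat \<bar>n'\<bar>) \<le> T"
          using abs_le_abs_mult[of "int k * int k" n'] nz n' assms(4) by simp
      qed (use nz in auto)
      finally show ?thesis by simp
    qed
  qed
  also have "card {d. d dvd nat \<bar>n\<bar>} \<le> t" using assms by (intro divs) auto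
  finally show ?thesis by (simp add: S_def)
qed

text \<open>The divisor bound enters twice, each time with exponent \<open>\<epsilon>/4\<close>. The
  number of units is only logarithmic in \<open>T\<close> and is granted the remaining
  \<open>\<epsilon>/2\<close>.\<close>

lemma pell_bound:
  fixes \<epsilon> :: real
  assumes "\<epsilon> > 0"
  shows "\<exists>C\<ge>1. \<forall>D n M T :: int. D \<noteq> 0 \<longrightarrow> n \<noteq> 0 \<longrightarrow> \<bar>D\<bar> \<le> T \<longrightarrow> \<bar>n\<bar> \<le> T \<longrightarrow> 0 \<le> M \<longrightarrow> M \<le> T \<longrightarrow>
    real (card {(Y, X). Y * Y - D * X * X = n \<and> \<bar>Y\<bar> \<le> M \<and> \<bar>X\<bar> \<le> M}) \<le> C * real_of_int T powr \<epsilon>"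
proof -
  obtain C where C: "C \<ge> 1" "\<And>n::nat. n > 0 \<Longrightarrow> real (card {d. d dvd n}) \<le> C * real n powr (\<epsilon>/4)"
    using divisor_bound[of "\<epsilon>/4"] assms by auto
  \<comment> \<open>This is \<open>9 + 4 * (2 + 6 / (\<epsilon> * ln 2))\<close>: the unit count is
    \<open>9 + 4 * L\<close>, and the inner bracket is the constant in the bound for
    \<open>L\<close>.\<close>
  define C' where "C' = 17 + 24 / (\<epsilon> * ln 2)"
  have C': "C' \<ge> 1" using assms by (simp add: C'_def)
  have main: "real (card {(Y, X). Y * Y - D * X * X = n \<and> \<bar>Y\<bar> \<le> M \<and> \<bar>X\<bar> \<le> M})
      \<le> (3 * C * C' * C) * real_of_int T powr \<epsilon>"
    if h: "D \<noteq> 0" "n \<noteq> 0" "\<bar>D\<bar> \<le> T" "\<bar>n\<bar> \<le> T" "0 \<le> M" "M \<le> T" for D n M T :: int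
  proof -
    have T: "T \<ge> 1" using h by linarith
    define t where "t = nat \<lfloor>C * real_of_int T powr (\<epsilon>/4)\<rfloor>"
    \<comment> \<open>\<open>2 ^ L\<close> has to exceed the size \<open>(1 + T) * (M * M)\<close>
      of the units, which is at most \<open>2 * T ^ 3\<close>.\<close>
    define L where "L = nat \<lfloor>log 2 (2 * real_of_int T ^ 3)\<rfloor> + 1"
    define u where "u = 9 + 4 * L"
    have tpos: "C * real_of_int T powr (\<epsilon>/4) \<ge> 0" using C(1) by simp
    have lg: "log 2 (2 * real_of_int T ^ 3) = 1 + 3 * (ln (real_of_int T) / ln 2)"
      using T by (simp add: log_mult log_nat_power log_def ln_mult ln_realpow field_simps)
    have lnT: "0 \<le> ln (real_of_int T)" using T by simp
    have below: "(1 + T) * (M * M) < 2 ^ L"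
    proof -
      have "(1 + T) * (M * M) \<le> (2 * T) * (T * T)"
        using h T by (intro mult_mono) auto
      hence "real_of_int ((1 + T) * (M * M)) \<le> real_of_int ((2 * T) * (T * T))" by linarith
      also have "\<dots> = 2 * real_of_int T ^ 3" by (simp add: power3_eq_cube)
      also have "\<dots> = 2 powr (log 2 (2 * real_of_int T ^ 3))" using T by simp
      also have "\<dots> < 2 powr (real L)"
        unfolding L_def using lg lnT by (intro powr_less_mono) linarith+
      also have "\<dots> = real_of_int (2 ^ L)" by (simp add: powr_realpow)
      finally show ?thesis by linarith
    qed
    have "real L \<le> log 2 (2 * real_of_int T ^ 3) + 1"
      unfolding L_def using lg lnT by simp
    also have "\<dots> = 2 + 3 / ln 2 * ln (real_of_int T)" unfolding lg by simp
    also have "\<dots> \<le> 2 * real_of_int T powr (\<epsilon>/2) + 3 / ln 2 * (real_of_int T powr (\<epsilon>/2) / (\<epsilon>/2))"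
      using assms T by (intro add_mono mult_left_mono ln_powr_bound) (auto simp: ge_one_powr_ge_zero)
    finally have Lb: "real L \<le> (2 + 6 / (\<epsilon> * ln 2)) * real_of_int T powr (\<epsilon>/2)"
      by (simp add: field_simps)
    have "real u = 9 + 4 * real L" by (simp add: u_def)
    also have "\<dots> \<le> 9 * real_of_int T powr (\<epsilon>/2) + 4 * ((2 + 6 / (\<epsilon> * ln 2)) * real_of_int T powr (\<epsilon>/2))"
      using Lb assms T by (intro add_mono mult_left_mono) (auto simp: ge_one_powr_ge_zero)
    also have "\<dots> = C' * real_of_int T powr (\<epsilon>/2)" unfolding C'_def by (simp add: algebra_simps)
    finally have ub: "real u \<le> C' * real_of_int T powr (\<epsilon>/2)" .
    have tb: "real t \<le> C * real_of_int T powr (\<epsilon>/4)" unfolding t_def using tpos by linarith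
    have "card {(Y, X). Y * Y - D * X * X = n \<and> \<bar>Y\<bar> \<le> M \<and> \<bar>X\<bar> \<le> M} \<le> 3 * t * u * t"
    proof (rule pell_count[where T = T])
      fix m :: nat assume m: "m > 0" "int m \<le> T"
      have "real (card {d. d dvd m}) \<le> C * real m powr (\<epsilon>/4)" using C m by blast
      also have "\<dots> \<le> C * real_of_int T powr (\<epsilon>/4)"
        using C m assms by (intro mult_left_mono powr_mono2) auto
      finally show "card {d. d dvd m} \<le> t" unfolding t_def by linarith
    qed (use h pell_units[OF _ below] in \<open>auto simp: u_def\<close>)
    hence "real (card {(Y, X). Y * Y - D * X * X = n \<and> \<bar>Y\<bar> \<le> M \<and> \<bar>X\<bar> \<le> M}) \<le> real (3 * t * u * t)"
      by (rule of_nat_mono)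
    also have "\<dots> = 3 * real t * real u * real t" by simp
    also have "\<dots> \<le> 3 * (C * real_of_int T powr (\<epsilon>/4)) * (C' * real_of_int T powr (\<epsilon>/2)) * (C * real_of_int T powr (\<epsilon>/4))"
      using tb ub C C' by (intro mult_mono) auto
    also have "\<dots> = (3 * C * C' * C) * (real_of_int T powr (\<epsilon>/4) * real_of_int T powr (\<epsilon>/2) * real_of_int T powr (\<epsilon>/4))"
      by (simp add: algebra_simps)
    also have "real_of_int T powr (\<epsilon>/4) * real_of_int T powr (\<epsilon>/2) * real_of_int T powr (\<epsilon>/4) = real_of_int T powr \<epsilon>"
      by (simp flip: powr_add)
    finally show ?thesis .
  qed
  have "1 \<le> 3 * C" "1 \<le> C' * C" using C(1) C' mult_mono[of 1 C' 1 C] by auto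
  hence "1 \<le> 3 * C * C' * C" using mult_mono[of 1 "3 * C" 1 "C' * C"] by (simp add: mult.assoc)
  thus ?thesis using main by blast
qed

subsection \<open>Conics in the plane\<close>

text \<open>Along the line the equation is a quadratic polynomial in one parameter with three roots,
  so at \<open>(p1, p2)\<close> its linear and its quadratic part both vanish. Hence
  \<open>(e, -d)\<close> is a multiple of \<open>(p1, p2)\<close>, and the determinant is minus the
  quadratic form at \<open>(e, -d)\<close>.\<close>

lemma collinear_origin_degenerate:
  fixes a b c d e p1 p2 q1 q2 :: int
  assumes P: "a * p1 * p1 + 2 * b * p1 * p2 + c * p2 * p2 + 2 * d * p1 + 2 * e * p2 = 0"
    and Q: "a * q1 * q1 + 2 * b * q1 * q2 + c * q2 * q2 + 2 * d * q1 + 2 * e * q2 = 0"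
    and ne: "(p1, p2) \<noteq> (0, 0)" "(q1, q2) \<noteq> (0, 0)" "(p1, p2) \<noteq> (q1, q2)"
    and col: "p1 * q2 = p2 * q1"
  shows "2 * b * d * e - a * e * e - c * d * d = 0"
proof -
  have lin: "d * p1 + e * p2 = 0"
  proof (cases "p1 = 0")
    case False
    have "q1 \<noteq> 0" using col False ne by auto
    have "q1 \<noteq> p1" using col False ne by auto
    have "2 * q1 * (p1 - q1) * (d * p1 + e * p2) = 0" using P Q col by algebra
    thus ?thesis using \<open>q1 \<noteq> 0\<close> \<open>q1 \<noteq> p1\<close> by simp
  next
    case True
    hence "p2 \<noteq> 0" using ne by auto
    have "q2 \<noteq> 0" using col \<open>p2 \<noteq> 0\<close> True ne by auto
    have "q2 \<noteq> p2" using col \<open>p2 \<noteq> 0\<close> True ne by auto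
    have "2 * q2 * (p2 - q2) * (d * p1 + e * p2) = 0" using P Q col by algebra
    thus ?thesis using \<open>q2 \<noteq> 0\<close> \<open>q2 \<noteq> p2\<close> by simp
  qed
  have "p1 * p1 * (2 * b * d * e - a * e * e - c * d * d) = 0" using lin P by algebra
  moreover have "p2 * p2 * (2 * b * d * e - a * e * e - c * d * d) = 0" using lin P by algebra
  ultimately show ?thesis using ne(1) by auto
qed

text \<open>The determinant of the symmetric matrix with rows \<open>(a, b, d)\<close>,
  \<open>(b, c, e)\<close>, \<open>(d, e, g)\<close> does not change when the origin moves to
  \<open>(x, y)\<close>: half the gradient there replaces \<open>(d, e)\<close>, and the value there
  replaces \<open>g\<close>.\<close>

lemma conic_det_translate:
  fixes a b c d e g x y :: int
  shows "2 * b * (a * x + b * y + d) * (b * x + c * y + e) - a * (b * x + c * y + e) * (b * x + c * y + e)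
      - c * (a * x + b * y + d) * (a * x + b * y + d)
      - (b * b - a * c) * (a * x * x + 2 * b * x * y + c * y * y + 2 * d * x + 2 * e * y + g) =
    2 * b * d * e - a * e * e - c * d * d - (b * b - a * c) * g"
  by algebra

lemma conic_det_translate_zero:
  fixes a b c d e g x y :: int
  assumes "d' = a * x + b * y + d" "e' = b * x + c * y + e"
    and "a * x * x + 2 * b * x * y + c * y * y + 2 * d * x + 2 * e * y + g = 0"
  shows "2 * b * d' * e' - a * e' * e' - c * d' * d' =
         2 * b * d * e - a * e * e - c * d * d - (b * b - a * c) * g"
  using conic_det_translate[of b a x y d c e g] assms by simp

lemma conic_translate:
  fixes a b c d e g x y :: int
  assumes "d' = a * x + b * y + d" "e' = b * x + c * y + e"
    and "a * x * x + 2 * b * x * y + c * y * y + 2 * d * x + 2 * e * y + g = 0"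
    and "a * u * u + 2 * b * u * v + c * v * v + 2 * d * u + 2 * e * v + g = 0"
  shows "a * (u - x) * (u - x) + 2 * b * (u - x) * (v - y) + c * (v - y) * (v - y) + 2 * d' * (u - x) + 2 * e' * (v - y) = 0"
  using assms by algebra

lemma collinear_degenerate:
  fixes a b c d e p1 p2 q1 q2 r1 r2 :: int
  assumes P: "a * p1 * p1 + 2 * b * p1 * p2 + c * p2 * p2 + 2 * d * p1 + 2 * e * p2 = 0"
    and Q: "a * q1 * q1 + 2 * b * q1 * q2 + c * q2 * q2 + 2 * d * q1 + 2 * e * q2 = 0"
    and R: "a * r1 * r1 + 2 * b * r1 * r2 + c * r2 * r2 + 2 * d * r1 + 2 * e * r2 = 0"
    and ne: "(p1, p2) \<noteq> (r1, r2)" "(q1, q2) \<noteq> (r1, r2)" "(p1, p2) \<noteq> (q1, q2)"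
    and col: "(p1 - r1) * (q2 - r2) = (p2 - r2) * (q1 - r1)"
  shows "2 * b * d * e - a * e * e - c * d * d = 0"
proof -
  define d' e' where "d' = a * r1 + b * r2 + d" and "e' = b * r1 + c * r2 + e"
  have "2 * b * d' * e' - a * e' * e' - c * d' * d' = 0"
  proof (rule collinear_origin_degenerate)
    show "(p1 - r1) * (q2 - r2) = (p2 - r2) * (q1 - r1)" by (rule col)
    show "a * (p1 - r1) * (p1 - r1) + 2 * b * (p1 - r1) * (p2 - r2) + c * (p2 - r2) * (p2 - r2)
        + 2 * d' * (p1 - r1) + 2 * e' * (p2 - r2) = 0"
      by (rule conic_translate[OF d'_def e'_def, where g = 0]) (use P R in auto)
    show "a * (q1 - r1) * (q1 - r1) + 2 * b * (q1 - r1) * (q2 - r2) + c * (q2 - r2) * (q2 - r2)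
        + 2 * d' * (q1 - r1) + 2 * e' * (q2 - r2) = 0"
      by (rule conic_translate[OF d'_def e'_def, where g = 0]) (use Q R in auto)
  qed (use ne in auto)
  moreover have "2 * b * d' * e' - a * e' * e' - c * d' * d' =
         2 * b * d * e - a * e * e - c * d * d - (b * b - a * c) * 0"
    by (rule conic_det_translate_zero[OF d'_def e'_def]) (use R in simp)
  ultimately show ?thesis by simp
qed

lemma abs_mult_le: "\<bar>x\<bar> \<le> A \<Longrightarrow> \<bar>y\<bar> \<le> B \<Longrightarrow> \<bar>x * y\<bar> \<le> A * B" for x y A B :: int
  unfolding abs_mult by (rule mult_mono) linarith+

text \<open>
  In the coordinates \<open>\<xi>, \<eta>\<close>, scaled so as to stay integral, the points \<open>0, P, Q\<close> become
  \<open>(0, 0), (\<delta>, 0), (0, \<delta>)\<close>, so the conic is a combination of \<open>\<xi> (\<xi> - \<delta>)\<close>, \<open>\<xi> \<eta>\<close> and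
  \<open>\<eta> (\<eta> - \<delta>)\<close>. Its coefficient vector is orthogonal to the values of these three monomials
  at two further points, hence proportional to their cross product \<open>k\<close>.
\<close>

lemma five_points_conic:
  fixes a b c d e p1 p2 q1 q2 x4 y4 x5 y5 :: int
  assumes f_def: "f = (\<lambda>x y. a * x * x + 2 * b * x * y + c * y * y + 2 * d * x + 2 * e * y)"
    and \<delta>_def: "\<delta> = p1 * q2 - q1 * p2"
    and \<xi>_def: "\<xi> = (\<lambda>x y. x * q2 - y * q1)" and \<eta>_def: "\<eta> = (\<lambda>x y. p1 * y - p2 * x)"
    and m1_def: "m1 = (\<lambda>x y. \<xi> x y * (\<xi> x y - \<delta>))" and m2_def: "m2 = (\<lambda>x y. \<xi> x y * \<eta> x y)"
    and m3_def: "m3 = (\<lambda>x y. \<eta> x y * (\<eta> x y - \<delta>))"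
    and k1_def: "k1 = m2 x4 y4 * m3 x5 y5 - m3 x4 y4 * m2 x5 y5"
    and k2_def: "k2 = m3 x4 y4 * m1 x5 y5 - m1 x4 y4 * m3 x5 y5"
    and k3_def: "k3 = m1 x4 y4 * m2 x5 y5 - m2 x4 y4 * m1 x5 y5"
    and D: "b * b - a * c \<noteq> 0" and \<Delta>: "2 * b * d * e - a * e * e - c * d * d \<noteq> 0"
    and z: "f p1 p2 = 0" "f q1 q2 = 0" "f x4 y4 = 0" "f x5 y5 = 0"
    and dist: "distinct [(0, 0), (p1, p2), (q1, q2), (x4, y4), (x5, y5)]"
  shows "\<delta> \<noteq> 0" "k2 * k2 - 4 * k1 * k3 \<noteq> 0" "k1 * k3 * (k2 - k1 - k3) \<noteq> 0"
    "f x y = 0 \<Longrightarrow> k1 * m1 x y + k2 * m2 x y + k3 * m3 x y = 0"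
proof -
  note zf = z[unfolded f_def]
  have \<delta>0: "\<delta> \<noteq> 0"
  proof
    assume "\<delta> = 0"
    hence "p1 * q2 = p2 * q1" by (simp add: \<delta>_def mult.commute)
    from collinear_origin_degenerate[OF zf(1,2) _ _ _ this] show False using dist \<Delta> by simp
  qed
  have \<xi>0: "\<xi> x y \<noteq> 0" if "f x y = 0" "(0, 0) \<noteq> (x, y)" "(q1, q2) \<noteq> (x, y)" for x y
  proof
    assume "\<xi> x y = 0"
    hence "x * q2 = y * q1" by (simp add: \<xi>_def)
    from collinear_origin_degenerate[OF that(1)[unfolded f_def] zf(2) not_sym[OF that(2)] _ not_sym[OF that(3)] this] show False
      using dist \<Delta> by simp
  qed
  have \<eta>0: "\<eta> x y \<noteq> 0" if "f x y = 0" "(0, 0) \<noteq> (x, y)" "(p1, p2) \<noteq> (x, y)" for x y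
  proof
    assume "\<eta> x y = 0"
    hence "p1 * y = p2 * x" by (simp add: \<eta>_def)
    from collinear_origin_degenerate[OF zf(1) that(1)[unfolded f_def] _ not_sym[OF that(2)] that(3) this] show False
      using dist \<Delta> by simp
  qed
  have nz: "\<xi> x4 y4 \<noteq> 0" "\<eta> x4 y4 \<noteq> 0" "\<xi> x5 y5 \<noteq> 0" "\<eta> x5 y5 \<noteq> 0"
    using \<xi>0[OF z(3)] \<xi>0[OF z(4)] \<eta>0[OF z(3)] \<eta>0[OF z(4)] dist by simp_all
  \<comment> \<open>\<open>k3\<close> is a multiple of the orientation determinant of
    \<open>(p1, p2)\<close>, \<open>(x4, y4)\<close>, \<open>(x5, y5)\<close>, which are not
    collinear. In particular the cross product is not zero.\<close>
  have "k3 \<noteq> 0"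
  proof
    assume "k3 = 0"
    moreover have "\<xi> x4 y4 * \<xi> x5 y5 * ((\<xi> x4 y4 - \<delta>) * \<eta> x5 y5 - \<eta> x4 y4 * (\<xi> x5 y5 - \<delta>)) = k3"
      unfolding k3_def m1_def m2_def by (simp add: algebra_simps)
    ultimately have "\<xi> x4 y4 * \<xi> x5 y5 * ((\<xi> x4 y4 - \<delta>) * \<eta> x5 y5 - \<eta> x4 y4 * (\<xi> x5 y5 - \<delta>)) = 0"
      by simp
    hence "(\<xi> x4 y4 - \<delta>) * \<eta> x5 y5 - \<eta> x4 y4 * (\<xi> x5 y5 - \<delta>) = 0" using nz by simp
    moreover have "(\<xi> x4 y4 - \<delta>) * \<eta> x5 y5 - \<eta> x4 y4 * (\<xi> x5 y5 - \<delta>) =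
        \<delta> * ((x4 - p1) * (y5 - p2) - (y4 - p2) * (x5 - p1))"
      unfolding \<xi>_def \<eta>_def \<delta>_def by algebra
    ultimately have "(x4 - p1) * (y5 - p2) = (y4 - p2) * (x5 - p1)" using \<delta>0 by simp
    from collinear_degenerate[OF zf(3,4,1) not_sym not_sym _ this] show False
      using dist \<Delta> by simp
  qed
  \<comment> \<open>The coefficients of \<open>\<delta> * \<delta> * f\<close> with respect to
    \<open>m1\<close>, \<open>m2\<close>, \<open>m3\<close>: the quadratic part at \<open>P\<close>,
    twice its bilinear form at \<open>P\<close> and \<open>Q\<close>, and the quadratic part at
    \<open>Q\<close>.\<close>
  define v1 v2 v3 where "v1 = a * p1 * p1 + 2 * b * p1 * p2 + c * p2 * p2"
    and "v2 = 2 * (a * p1 * q1 + b * (p1 * q2 + p2 * q1) + c * p2 * q2)"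
    and "v3 = a * q1 * q1 + 2 * b * q1 * q2 + c * q2 * q2"
  have lp: "v1 = - 2 * (d * p1 + e * p2)" and lq: "v3 = - 2 * (d * q1 + e * q2)"
    using z(1,2) unfolding f_def v1_def v3_def by algebra+
  have trans: "v1 * m1 x y + v2 * m2 x y + v3 * m3 x y = \<delta> * \<delta> * f x y" for x y
  proof -
    have "v1 * m1 x y + v2 * m2 x y + v3 * m3 x y =
        (v1 * \<xi> x y * \<xi> x y + v2 * \<xi> x y * \<eta> x y + v3 * \<eta> x y * \<eta> x y) - \<delta> * (v1 * \<xi> x y + v3 * \<eta> x y)"
      unfolding m1_def m2_def m3_def by algebra
    also have "v1 * \<xi> x y * \<xi> x y + v2 * \<xi> x y * \<eta> x y + v3 * \<eta> x y * \<eta> x y =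
        \<delta> * \<delta> * (a * x * x + 2 * b * x * y + c * y * y)"
      unfolding v1_def v2_def v3_def \<xi>_def \<eta>_def \<delta>_def by algebra
    also have "v1 * \<xi> x y + v3 * \<eta> x y = - 2 * \<delta> * (d * x + e * y)"
      unfolding lp lq \<xi>_def \<eta>_def \<delta>_def by algebra
    finally show ?thesis unfolding f_def by algebra
  qed
  have o4: "v1 * m1 x4 y4 + v2 * m2 x4 y4 + v3 * m3 x4 y4 = 0"
    and o5: "v1 * m1 x5 y5 + v2 * m2 x5 y5 + v3 * m3 x5 y5 = 0"
    using trans z by simp_all
  have prop1: "k3 * v1 = v3 * k1" and prop2: "k3 * v2 = v3 * k2"
  proof -
    have "k3 * v1 - v3 * k1 = m2 x5 y5 * (v1 * m1 x4 y4 + v2 * m2 x4 y4 + v3 * m3 x4 y4)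
        - m2 x4 y4 * (v1 * m1 x5 y5 + v2 * m2 x5 y5 + v3 * m3 x5 y5)"
      unfolding k1_def k3_def by algebra
    thus "k3 * v1 = v3 * k1" unfolding o4 o5 by simp
    have "k3 * v2 - v3 * k2 = m1 x4 y4 * (v1 * m1 x5 y5 + v2 * m2 x5 y5 + v3 * m3 x5 y5)
        - m1 x5 y5 * (v1 * m1 x4 y4 + v2 * m2 x4 y4 + v3 * m3 x4 y4)"
      unfolding k2_def k3_def by algebra
    thus "k3 * v2 = v3 * k2" unfolding o4 o5 by simp
  qed
  \<comment> \<open>Discriminant and determinant in the new coordinates, up to nonzero factors. They
    are homogeneous of degrees 2 and 3 in the coefficients, so their nonvanishing passes from
    \<open>v\<close> to the proportional vector \<open>k\<close>.\<close>
  have vD: "v2 * v2 - 4 * v1 * v3 = 4 * (\<delta> * \<delta>) * (b * b - a * c)"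
    unfolding v1_def v2_def v3_def \<delta>_def by algebra
  have v\<Delta>: "v1 * v3 * (v2 - v1 - v3) = 4 * (\<delta> * \<delta>) * (2 * b * d * e - a * e * e - c * d * d)"
  proof -
    define s t where "s = d * p1 + e * p2" and "t = d * q1 + e * q2"
    have "\<delta> * \<delta> * (2 * b * d * e - a * e * e - c * d * d) = v2 * s * t - v1 * t * t - v3 * s * s"
      unfolding v1_def v2_def v3_def s_def t_def \<delta>_def by algebra
    moreover have "v1 = - 2 * s" "v3 = - 2 * t" using lp lq by (simp_all add: s_def t_def)
    ultimately show ?thesis by algebra
  qed
  have e1: "k3 * k3 * (v2 * v2 - 4 * v1 * v3) = v3 * v3 * (k2 * k2 - 4 * k1 * k3)"
  proof -
    have "k3 * k3 * (v2 * v2 - 4 * v1 * v3) = (k3 * v2) * (k3 * v2) - 4 * (k3 * v1) * (k3 * v3)" by algebra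
    thus ?thesis unfolding prop1 prop2 by algebra
  qed
  have e2: "k3 * k3 * k3 * (v1 * v3 * (v2 - v1 - v3)) = v3 * v3 * v3 * (k1 * k3 * (k2 - k1 - k3))"
  proof -
    have "k3 * k3 * k3 * (v1 * v3 * (v2 - v1 - v3)) = (k3 * v1) * (k3 * v3) * (k3 * v2 - k3 * v1 - k3 * v3)" by algebra
    thus ?thesis unfolding prop1 prop2 by algebra
  qed
  have vnz: "v2 * v2 - 4 * v1 * v3 \<noteq> 0" "v1 * v3 * (v2 - v1 - v3) \<noteq> 0"
    using vD v\<Delta> \<delta>0 D \<Delta> by simp_all
  show "\<delta> \<noteq> 0" by fact
  show "k2 * k2 - 4 * k1 * k3 \<noteq> 0"
    using e1 vnz(1) \<open>k3 \<noteq> 0\<close> by (metis mult_eq_0_iff)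
  show "k1 * k3 * (k2 - k1 - k3) \<noteq> 0"
    using e2 vnz(2) \<open>k3 \<noteq> 0\<close> by (metis mult_eq_0_iff)
  show "k1 * m1 x y + k2 * m2 x y + k3 * m3 x y = 0" if "f x y = 0"
  proof -
    have "v1 * m1 x y + v2 * m2 x y + v3 * m3 x y = 0" using trans[of x y] that by simp
    moreover have "k3 * (v1 * m1 x y + v2 * m2 x y + v3 * m3 x y) =
        (k3 * v1) * m1 x y + (k3 * v2) * m2 x y + v3 * k3 * m3 x y" by algebra
    ultimately have "(v3 * k1) * m1 x y + (v3 * k2) * m2 x y + v3 * k3 * m3 x y = 0"
      unfolding prop1 prop2 by simp
    hence "v3 * (k1 * m1 x y + k2 * m2 x y + k3 * m3 x y) = 0" by algebra
    moreover have "v3 \<noteq> 0" using vnz(2) by auto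
    ultimately show ?thesis by simp
  qed
qed

lemma card_ge_5E:
  assumes "card S > 4" "s \<in> S"
  obtains p q r t where "p \<in> S" "q \<in> S" "r \<in> S" "t \<in> S" "distinct [s, p, q, r, t]"
proof -
  have "finite S" using assms(1) by (metis card.infinite not_less_zero)
  hence "4 \<le> card (S - {s})" using assms by simp
  then obtain A where A: "A \<subseteq> S - {s}" "card A = 4" by (meson obtain_subset_with_card_n)
  obtain xs where xs: "set xs = A" "distinct xs" "length xs = 4"
    using A(2) by (metis card.infinite distinct_card finite_distinct_list zero_neq_numeral)
  then obtain p q r t where "xs = [p, q, r, t]"
    by (auto simp: numeral_eq_Suc length_Suc_conv)
  thus ?thesis using xs A(1) by (intro that[of p q r t]) auto
qed

text \<open>Five points allow the equation to be replaced by
  \<open>k1 * m1 + k2 * m2 + k3 * m3 = 0\<close>, whose coefficients are bounded by a power of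
  \<open>N\<close>. Multiplication by \<open>4 * k1\<close> completes the square in
  \<open>\<xi>\<close>, a further multiplication by the discriminant completes it in
  \<open>\<eta>\<close>.\<close>

lemma conic_origin_pell:
  fixes a b c d e N :: int
  defines "S \<equiv> {(x, y). a * x * x + 2 * b * x * y + c * y * y + 2 * d * x + 2 * e * y = 0 \<and> \<bar>x\<bar> \<le> N \<and> \<bar>y\<bar> \<le> N}"
  assumes D: "b * b - a * c \<noteq> 0" and \<Delta>: "2 * b * d * e - a * e * e - c * d * d \<noteq> 0"
    and N: "N \<ge> 1"
  shows "card S \<le> 4 \<or> (\<exists>D n. D \<noteq> 0 \<and> n \<noteq> 0 \<and> \<bar>D\<bar> \<le> 2 ^ 34 * N ^ 36 \<and> \<bar>n\<bar> \<le> 2 ^ 34 * N ^ 36 \<and>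
     card S \<le> card {(Y, X). Y * Y - D * X * X = n \<and> \<bar>Y\<bar> \<le> 2 ^ 34 * N ^ 36 \<and> \<bar>X\<bar> \<le> 2 ^ 34 * N ^ 36})"
proof (cases "card S \<le> 4")
  case False
  have "(0, 0) \<in> S" using N by (simp add: S_def)
  then obtain P Q P4 P5 where mem: "P \<in> S" "Q \<in> S" "P4 \<in> S" "P5 \<in> S" and dist: "distinct [(0, 0), P, Q, P4, P5]"
    using False by (metis card_ge_5E not_le)
  obtain p1 p2 q1 q2 x4 y4 x5 y5 where e: "P = (p1, p2)" "Q = (q1, q2)" "P4 = (x4, y4)" "P5 = (x5, y5)"
    by (cases P, cases Q, cases P4, cases P5)
  define \<delta> where "\<delta> = p1 * q2 - q1 * p2"
  define \<xi> where "\<xi> = (\<lambda>x y. x * q2 - y * q1)"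
  define \<eta> where "\<eta> = (\<lambda>x y. p1 * y - p2 * x)"
  define m1 where "m1 = (\<lambda>x y. \<xi> x y * (\<xi> x y - \<delta>))"
  define m2 where "m2 = (\<lambda>x y. \<xi> x y * \<eta> x y)"
  define m3 where "m3 = (\<lambda>x y. \<eta> x y * (\<eta> x y - \<delta>))"
  define k1 where "k1 = m2 x4 y4 * m3 x5 y5 - m3 x4 y4 * m2 x5 y5"
  define k2 where "k2 = m3 x4 y4 * m1 x5 y5 - m1 x4 y4 * m3 x5 y5"
  define k3 where "k3 = m1 x4 y4 * m2 x5 y5 - m2 x4 y4 * m1 x5 y5"
  define f where "f = (\<lambda>x y. a * x * x + 2 * b * x * y + c * y * y + 2 * d * x + 2 * e * y)"
  have z: "f p1 p2 = 0" "f q1 q2 = 0" "f x4 y4 = 0" "f x5 y5 = 0"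
    and bd: "\<bar>p1\<bar> \<le> N" "\<bar>p2\<bar> \<le> N" "\<bar>q1\<bar> \<le> N" "\<bar>q2\<bar> \<le> N" "\<bar>x4\<bar> \<le> N" "\<bar>y4\<bar> \<le> N" "\<bar>x5\<bar> \<le> N" "\<bar>y5\<bar> \<le> N"
    using mem e by (auto simp: S_def f_def)
  note five = five_points_conic[OF f_def \<delta>_def \<xi>_def \<eta>_def m1_def m2_def m3_def k1_def k2_def k3_def D \<Delta> z dist[unfolded e]]
  define R where "R = N * N"
  have R: "R \<ge> 1" using N mult_mono[of 1 N 1 N] by (simp add: R_def)
  have two: "\<bar>x * y - u * v\<bar> \<le> 2 * (A * B)" if "\<bar>x\<bar> \<le> A" "\<bar>y\<bar> \<le> B" "\<bar>u\<bar> \<le> A" "\<bar>v\<bar> \<le> B" for x y u v A B :: int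
    using abs_mult_le[OF that(1,2)] abs_mult_le[OF that(3,4)] by linarith
  have b\<delta>: "\<bar>\<delta>\<bar> \<le> 2 * R" unfolding \<delta>_def R_def by (rule two) (use bd in auto)
  have b\<xi>: "\<bar>\<xi> x y\<bar> \<le> 2 * R" if "\<bar>x\<bar> \<le> N" "\<bar>y\<bar> \<le> N" for x y
    unfolding \<xi>_def R_def by (rule two) (use bd that in auto)
  have b\<eta>: "\<bar>\<eta> x y\<bar> \<le> 2 * R" if "\<bar>x\<bar> \<le> N" "\<bar>y\<bar> \<le> N" for x y
    unfolding \<eta>_def R_def by (rule two) (use bd that in auto)
  have bm: "\<bar>m1 x y\<bar> \<le> 2 * R * (4 * R)" "\<bar>m2 x y\<bar> \<le> 2 * R * (4 * R)" "\<bar>m3 x y\<bar> \<le> 2 * R * (4 * R)"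
    if "\<bar>x\<bar> \<le> N" "\<bar>y\<bar> \<le> N" for x y
    unfolding m1_def m2_def m3_def
    by (rule abs_mult_le; use b\<xi>[OF that] b\<eta>[OF that] b\<delta> R in linarith)+
  define K where "K = 2 * ((2 * R * (4 * R)) * (2 * R * (4 * R)))"
  have bk: "\<bar>k1\<bar> \<le> K" "\<bar>k2\<bar> \<le> K" "\<bar>k3\<bar> \<le> K"
    unfolding k1_def k2_def k3_def K_def
    by (rule two; rule bm[OF bd(5,6)] bm[OF bd(7,8)])+
  \<comment> \<open>\<open>n\<close> is \<open>(k1 * \<delta>)\<^sup>2\<close> times
    \<open>(k2 - 2 * k3)\<^sup>2 - D'\<close>. It contains the determinant of the conic as a factor,
    so it is nonzero.\<close>
  define D' n where "D' = k2 * k2 - 4 * k1 * k3" and "n = - 4 * (k1 * \<delta> * \<delta>) * (k1 * k3 * (k2 - k1 - k3))"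
  \<comment> \<open>The largest quantity to be bounded is \<open>n\<close>, with
    \<open>48 * K ^ 4 * R ^ 2 = 3 * 2 ^ 32 * R ^ 18\<close> because
    \<open>K = 2 ^ 7 * R ^ 4\<close>.\<close>
  define T where "T = 2 ^ 34 * N ^ 36"
  have RK: "K = 128 * R ^ 4" by (simp add: K_def power4_eq_xxxx)
  have TR: "T = 17179869184 * R ^ 18" by (simp add: T_def R_def power_mult_distrib flip: power_add)
  have Rle: "R ^ i \<le> R ^ 18" if "i \<le> 18" for i using that R by (rule power_increasing)
  have Rge: "R ^ i \<ge> 0" for i using R by simp
  have bD: "\<bar>D'\<bar> \<le> 5 * (K * K)"
    using abs_mult_le[OF bk(2) bk(2)] abs_mult_le[OF bk(1) bk(3)] unfolding D'_def by linarith
  have bDT: "5 * (K * K) \<le> T"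
  proof -
    have "5 * (K * K) = 81920 * R ^ 8" unfolding RK by algebra
    thus ?thesis using Rle[of 8] Rge[of 18] unfolding TR by linarith
  qed
  have bn: "\<bar>n\<bar> \<le> 4 * (K * (2 * R) * (2 * R)) * (K * K * (3 * K))"
    unfolding n_def using bk b\<delta> by (intro abs_mult_le) auto
  have bnT: "4 * (K * (2 * R) * (2 * R)) * (K * K * (3 * K)) \<le> T"
  proof -
    have "4 * (K * (2 * R) * (2 * R)) * (K * K * (3 * K)) = 12884901888 * R ^ 18"
      unfolding RK by algebra
    thus ?thesis using Rge[of 18] unfolding TR by linarith
  qed
  define F where "F = (\<lambda>(x, y). (D' * \<eta> x y - k1 * \<delta> * (k2 - 2 * k3), 2 * k1 * \<xi> x y + k2 * \<eta> x y - k1 * \<delta>))"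
  define S' where "S' = {(Y, X). Y * Y - D' * X * X = n \<and> \<bar>Y\<bar> \<le> T \<and> \<bar>X\<bar> \<le> T}"
  have nz: "\<delta> \<noteq> 0" "D' \<noteq> 0" "k1 \<noteq> 0" "n \<noteq> 0" using five(1-3) by (auto simp: D'_def n_def)
  have "F ` S \<subseteq> S'"
  proof (rule image_subsetI)
    fix p assume "p \<in> S"
    then obtain x y where p: "p = (x, y)" and xy: "(x, y) \<in> S" by (cases p) auto
    hence b: "\<bar>x\<bar> \<le> N" "\<bar>y\<bar> \<le> N" and "f x y = 0" by (auto simp: S_def f_def)
    define s t where "s = \<xi> x y" and "t = \<eta> x y"
    have "k1 * m1 x y + k2 * m2 x y + k3 * m3 x y = 0" using five(4) \<open>f x y = 0\<close> .
    hence eq: "k1 * (s * (s - \<delta>)) + k2 * (s * t) + k3 * (t * (t - \<delta>)) = 0"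
      by (simp add: m1_def m2_def m3_def s_def t_def)
    define Y X where "Y = D' * t - k1 * \<delta> * (k2 - 2 * k3)" and "X = 2 * k1 * s + k2 * t - k1 * \<delta>"
    have "Y * Y - D' * X * X = n"
      using eq unfolding Y_def X_def D'_def n_def by algebra
    moreover have "\<bar>D' * t\<bar> \<le> 5 * (K * K) * (2 * R)"
      unfolding t_def by (intro abs_mult_le bD b\<eta> b)
    moreover have "\<bar>k1 * \<delta> * (k2 - 2 * k3)\<bar> \<le> K * (2 * R) * (3 * K)"
      using bk b\<delta> by (intro abs_mult_le) auto
    moreover have "5 * (K * K) * (2 * R) + K * (2 * R) * (3 * K) \<le> T"
    proof -
      have "5 * (K * K) * (2 * R) + K * (2 * R) * (3 * K) = 262144 * R ^ 9" unfolding RK by algebra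
      thus ?thesis using Rle[of 9] Rge[of 18] unfolding TR by linarith
    qed
    moreover have "\<bar>2 * k1 * s\<bar> \<le> 2 * K * (2 * R)" "\<bar>k2 * t\<bar> \<le> K * (2 * R)" "\<bar>k1 * \<delta>\<bar> \<le> K * (2 * R)"
    proof -
      have "\<bar>2 * k1\<bar> \<le> 2 * K" using bk(1) by linarith
      from abs_mult_le[OF this b\<xi>[OF b]] show "\<bar>2 * k1 * s\<bar> \<le> 2 * K * (2 * R)" by (simp only: s_def)
      show "\<bar>k2 * t\<bar> \<le> K * (2 * R)" unfolding t_def by (rule abs_mult_le[OF bk(2) b\<eta>[OF b]])
      show "\<bar>k1 * \<delta>\<bar> \<le> K * (2 * R)" by (rule abs_mult_le[OF bk(1) b\<delta>])
    qed
    moreover have "2 * K * (2 * R) + K * (2 * R) + K * (2 * R) \<le> T"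
    proof -
      have "2 * K * (2 * R) + K * (2 * R) + K * (2 * R) = 1024 * R ^ 5" unfolding RK by algebra
      thus ?thesis using Rle[of 5] Rge[of 18] unfolding TR by linarith
    qed
    ultimately have "Y * Y - D' * X * X = n" "\<bar>Y\<bar> \<le> T" "\<bar>X\<bar> \<le> T"
      unfolding Y_def X_def by linarith+
    hence "(Y, X) \<in> S'" by (simp add: S'_def)
    thus "F p \<in> S'" by (simp add: p F_def Y_def X_def s_def t_def)
  qed
  moreover have "inj_on F S"
  proof (rule inj_onI)
    fix u v assume "F u = F v"
    obtain x y x' y' where uv: "u = (x, y)" "v = (x', y')" by (cases u, cases v)
    have "D' * \<eta> x y = D' * \<eta> x' y'" using \<open>F u = F v\<close> uv by (simp add: F_def)
    hence 1: "\<eta> x y = \<eta> x' y'" using nz by simp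
    hence "2 * k1 * \<xi> x y = 2 * k1 * \<xi> x' y'" using \<open>F u = F v\<close> uv by (simp add: F_def)
    hence 2: "\<xi> x y = \<xi> x' y'" using nz by simp
    have inv: "\<delta> * x = \<xi> x y * p1 + \<eta> x y * q1 \<and> \<delta> * y = \<xi> x y * p2 + \<eta> x y * q2" for x y
      unfolding \<delta>_def \<xi>_def \<eta>_def by (simp add: algebra_simps)
    have "\<delta> * x = \<delta> * x'" "\<delta> * y = \<delta> * y'" using inv[of x y] inv[of x' y'] 1 2 by simp_all
    thus "u = v" using nz uv by simp
  qed
  moreover have "finite S'"
    by (rule finite_subset[of _ "{-T..T} \<times> {-T..T}"]) (auto simp: S'_def)
  ultimately have "card S \<le> card S'" by (intro card_inj_on_le[of F])
  hence "D' \<noteq> 0 \<and> n \<noteq> 0 \<and> \<bar>D'\<bar> \<le> T \<and> \<bar>n\<bar> \<le> T \<and>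
      card S \<le> card {(Y, X). Y * Y - D' * X * X = n \<and> \<bar>Y\<bar> \<le> T \<and> \<bar>X\<bar> \<le> T}"
    using nz bD bDT bn bnT unfolding S'_def by linarith
  thus ?thesis unfolding T_def by blast
qed simp

text \<open>Moving the origin to a point of the conic removes the constant term and doubles the box.
  The exponent \<open>\<epsilon>/36\<close> in the Pell bound compensates for sizes that grow like
  \<open>N ^ 36\<close>.\<close>

lemma conic_bound:
  fixes \<epsilon> :: real
  assumes "\<epsilon> > 0"
  shows "\<exists>C\<ge>1. \<forall>a b c d e g N :: int. b * b - a * c \<noteq> 0 \<longrightarrow>
    2 * b * d * e - a * e * e - c * d * d - (b * b - a * c) * g \<noteq> 0 \<longrightarrow> N \<ge> 1 \<longrightarrow>
    real (card {(x, y). a * x * x + 2 * b * x * y + c * y * y + 2 * d * x + 2 * e * y + g = 0 \<and> \<bar>x\<bar> \<le> N \<and> \<bar>y\<bar> \<le> N})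
      \<le> C * real_of_int N powr \<epsilon>"
proof -
  obtain C where C: "C \<ge> 1" "\<And>D n M T :: int. D \<noteq> 0 \<Longrightarrow> n \<noteq> 0 \<Longrightarrow> \<bar>D\<bar> \<le> T \<Longrightarrow> \<bar>n\<bar> \<le> T \<Longrightarrow> 0 \<le> M \<Longrightarrow> M \<le> T \<Longrightarrow>
    real (card {(Y, X). Y * Y - D * X * X = n \<and> \<bar>Y\<bar> \<le> M \<and> \<bar>X\<bar> \<le> M}) \<le> C * real_of_int T powr (\<epsilon>/36)"
    using pell_bound[of "\<epsilon>/36"] assms by auto
  \<comment> \<open>The 4 is for conics with fewer than five points; the rest comes from
    \<open>2 ^ 34 * (2 * N) ^ 36 = 2 ^ 70 * N ^ 36\<close>.\<close>
  define C' where "C' = 4 + C * 2 powr (70 * \<epsilon> / 36)"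
  have "real (card {(x, y). a * x * x + 2 * b * x * y + c * y * y + 2 * d * x + 2 * e * y + g = 0 \<and> \<bar>x\<bar> \<le> N \<and> \<bar>y\<bar> \<le> N})
      \<le> C' * real_of_int N powr \<epsilon>"
    if D: "b * b - a * c \<noteq> 0" and \<Delta>: "2 * b * d * e - a * e * e - c * d * d - (b * b - a * c) * g \<noteq> 0" and N: "N \<ge> 1"
    for a b c d e g N :: int
  proof -
    define S where "S = {(x, y). a * x * x + 2 * b * x * y + c * y * y + 2 * d * x + 2 * e * y + g = 0 \<and> \<bar>x\<bar> \<le> N \<and> \<bar>y\<bar> \<le> N}"
    have N1: "real_of_int N powr \<epsilon> \<ge> 1" using N assms by (intro ge_one_powr_ge_zero) auto
    have "real (card S) \<le> C' * real_of_int N powr \<epsilon>"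
    proof (cases "S = {}")
      case True
      have "C' \<ge> 0" using C(1) by (simp add: C'_def)
      thus ?thesis using True by simp
    next
      case False
      then obtain x y where xy: "(x, y) \<in> S" by auto
      define d' e' where "d' = a * x + b * y + d" and "e' = b * x + c * y + e"
      define S' where "S' = {(x, y). a * x * x + 2 * b * x * y + c * y * y + 2 * d' * x + 2 * e' * y = 0 \<and> \<bar>x\<bar> \<le> 2 * N \<and> \<bar>y\<bar> \<le> 2 * N}"
      have f0: "a * x * x + 2 * b * x * y + c * y * y + 2 * d * x + 2 * e * y + g = 0" using xy by (simp add: S_def)
      have \<Delta>': "2 * b * d' * e' - a * e' * e' - c * d' * d' \<noteq> 0"
        using conic_det_translate_zero[OF d'_def e'_def f0] \<Delta> by simp
      have "card S \<le> card S'"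
      proof (rule card_inj_on_le)
        show "inj_on (\<lambda>p. (fst p - x, snd p - y)) S" by (auto intro!: inj_onI simp: prod_eq_iff)
        show "(\<lambda>p. (fst p - x, snd p - y)) ` S \<subseteq> S'"
        proof safe
          fix u v assume uv: "(u, v) \<in> S"
          have "a * (u - x) * (u - x) + 2 * b * (u - x) * (v - y) + c * (v - y) * (v - y) + 2 * d' * (u - x) + 2 * e' * (v - y) = 0"
            by (rule conic_translate[OF d'_def e'_def f0]) (use uv in \<open>simp add: S_def\<close>)
          moreover have "\<bar>u - x\<bar> \<le> 2 * N" "\<bar>v - y\<bar> \<le> 2 * N" using uv xy by (auto simp: S_def)
          ultimately show "(fst (u, v) - x, snd (u, v) - y) \<in> S'" by (simp add: S'_def)
        qed
        show "finite S'"
          by (rule finite_subset[of _ "{-(2*N)..2*N} \<times> {-(2*N)..2*N}"]) (auto simp: S'_def)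
      qed
      moreover have "real (card S') \<le> C' * real_of_int N powr \<epsilon>"
      proof -
        have "1 \<le> 2 * N" using N by simp
        from conic_origin_pell[OF D \<Delta>' this, folded S'_def] consider
          "card S' \<le> 4" | D n where "D \<noteq> 0" "n \<noteq> 0"
            "\<bar>D\<bar> \<le> 2 ^ 34 * (2 * N) ^ 36" "\<bar>n\<bar> \<le> 2 ^ 34 * (2 * N) ^ 36"
            "card S' \<le> card {(Y, X). Y * Y - D * X * X = n \<and>
              \<bar>Y\<bar> \<le> 2 ^ 34 * (2 * N) ^ 36 \<and> \<bar>X\<bar> \<le> 2 ^ 34 * (2 * N) ^ 36}"
          by blast
        thus ?thesis
        proof cases
        case 1
        have "C * 2 powr (70 * \<epsilon> / 36) \<ge> 0" using C(1) by simp
        hence "4 * 1 \<le> C' * real_of_int N powr \<epsilon>" using N1 by (intro mult_mono) (auto simp: C'_def)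
        thus ?thesis using 1 by linarith
      next
        case (2 D n)
        define T where "T = 2 ^ 34 * (2 * N) ^ 36"
        have "real (card S') \<le> C * real_of_int T powr (\<epsilon>/36)"
          using C(2)[of D n T T] 2 N unfolding T_def by simp
        also have "real_of_int T = 2 ^ 70 * real_of_int N ^ 36" by (simp add: T_def power_mult_distrib)
        also have "\<dots> powr (\<epsilon>/36) = (2 ^ 70) powr (\<epsilon>/36) * (real_of_int N ^ 36) powr (\<epsilon>/36)"
          using N by (simp add: powr_mult)
        also have "(real_of_int N ^ 36) powr (\<epsilon>/36) = real_of_int N powr \<epsilon>"
          using N by (simp add: powr_powr flip: powr_numeral)
        also have "((2::real) ^ 70) powr (\<epsilon>/36) = 2 powr (70 * \<epsilon> / 36)"
          by (simp only: powr_numeral[symmetric] powr_powr) simp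
        also have "C * (2 powr (70 * \<epsilon> / 36) * real_of_int N powr \<epsilon>) \<le> C' * real_of_int N powr \<epsilon>"
          by (simp add: C'_def algebra_simps)
        finally show ?thesis .
      qed
      qed
      ultimately show ?thesis by linarith
    qed
    thus ?thesis by (simp add: S_def)
  qed
  moreover have "C' \<ge> 1" using C(1) by (simp add: C'_def)
  ultimately show ?thesis by blast
qed

subsection \<open>Zeros in coordinate boxes\<close>

lemma quadratic_roots_int:
  fixes a b c :: int
  shows "(\<forall>z. a * z * z + b * z + c = 0) \<or>
    (finite {z. a * z * z + b * z + c = 0} \<and> card {z. a * z * z + b * z + c = 0} \<le> 2)"
proof (cases "[:c, b, a:] = 0")
  case False
  have "{z. poly [:c, b, a:] z = 0} = {z. a * z * z + b * z + c = 0}"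
    by (auto simp: algebra_simps)
  moreover have "degree [:c, b, a:] \<le> 2" by simp
  ultimately show ?thesis
    using poly_roots_finite[OF False] card_poly_roots_bound[OF False] by (metis order_trans)
qed simp

text \<open>The vectors stay in the full lattice and vanish outside \<open>K\<close>, so that
  \<open>K\<close> can grow by one coordinate without a change of type.\<close>

definition coord_box :: "'n::finite set \<Rightarrow> int \<Rightarrow> (int ^ 'n) set" where
  "coord_box K R = {s. (\<forall>i\<in>K. \<bar>s $ i\<bar> \<le> R) \<and> (\<forall>i. i \<notin> K \<longrightarrow> s $ i = 0)}"

lemma coord_box_insert:
  assumes "i \<notin> K"
  shows "coord_box (insert i K) R \<subseteq> (\<Union>z\<in>{-R..R}. (\<lambda>s. s + axis i z) ` coord_box K R)"
proof
  fix s assume s: "s \<in> coord_box (insert i K) R"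
  have "s = (s - axis i (s $ i)) + axis i (s $ i)" by simp
  moreover have "s - axis i (s $ i) \<in> coord_box K R"
    using s assms by (auto simp: coord_box_def axis_def)
  moreover have "s $ i \<in> {-R..R}" using s by (auto simp: coord_box_def)
  ultimately show "s \<in> (\<Union>z\<in>{-R..R}. (\<lambda>s. s + axis i z) ` coord_box K R)" by blast
qed

lemma coord_box_card:
  assumes "finite K" "R \<ge> 0"
  shows "finite (coord_box K R :: (int ^ 'n::finite) set) \<and>
    card (coord_box K R :: (int ^ 'n::finite) set) \<le> nat (2 * R + 1) ^ card K"
  using assms(1)
proof (induction K rule: finite_induct)
  case empty
  have "coord_box {} R = {0 :: int ^ 'n}" by (auto simp: coord_box_def vec_eq_iff)
  thus ?case by simp
next
  case (insert i K)
  let ?U = "\<Union>z\<in>{-R..R}. (\<lambda>s. s + axis i z) ` (coord_box K R :: (int ^ 'n) set)"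
  have fin: "finite ?U" using insert.IH by blast
  have "card ?U \<le> (\<Sum>z\<in>{-R..R}. card ((\<lambda>s. s + axis i z) ` (coord_box K R :: (int ^ 'n) set)))"
    by (rule card_UN_le) simp
  also have "\<dots> \<le> (\<Sum>z\<in>{-R..R}. nat (2 * R + 1) ^ card K)"
    using insert.IH by (intro sum_mono order_trans[OF card_image_le]) auto
  also have "\<dots> = nat (2 * R + 1) ^ card (insert i K)"
    using insert.hyps assms(2) by (simp add: algebra_simps)
  finally show ?case
    using finite_subset[OF coord_box_insert[OF insert.hyps(2)] fin]
      card_mono[OF fin coord_box_insert[OF insert.hyps(2)]] by linarith
qed

text \<open>A Schwartz-Zippel count for a function that behaves like a polynomial of degree at most
  2 in each variable. The anchor \<open>s0\<close> has to be supported in \<open>K\<close> but may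
  lie outside the box: its role is to leave at most two bad values of the coordinate that is split
  off.\<close>

lemma coord_box_zeros:
  fixes h :: "int ^ 'n::finite \<Rightarrow> int"
  assumes "finite K" "R \<ge> 0"
    and "\<And>s i. (\<forall>z. h (s + axis i z) = 0) \<or> (finite {z. h (s + axis i z) = 0} \<and> card {z. h (s + axis i z) = 0} \<le> 2)"
    and "\<And>i. i \<notin> K \<Longrightarrow> s0 $ i = 0" "h s0 \<noteq> 0"
  shows "card {s \<in> coord_box K R. h s = 0} \<le> 2 * card K * nat (2 * R + 1) ^ (card K - 1)"
  using assms(1,3-5)
proof (induction K arbitrary: h s0 rule: finite_induct)
  case empty
  have "s0 = 0" using empty.prems(2) by (simp add: vec_eq_iff)
  hence none: "{s \<in> coord_box {} R. h s = 0} = {}"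
    using empty.prems(3) by (auto simp: coord_box_def) (metis vec_eq_iff zero_index)
  show ?case unfolding none by simp
next
  case (insert i K)
  define M where "M = nat (2 * R + 1)"
  \<comment> \<open>The anchor with its \<open>i\<close>-th entry cleared serves every slice
    \<open>z\<close> for which \<open>h (s1 + axis i z)\<close> is nonzero.\<close>
  define s1 where "s1 = s0 - axis i (s0 $ i)"
  define bad where "bad = {z. h (s1 + axis i z) = 0}"
  have "h (s1 + axis i (s0 $ i)) \<noteq> 0" using insert.prems(3) by (simp add: s1_def)
  hence bad: "finite bad" "card bad \<le> 2" using insert.prems(1)[of s1 i] unfolding bad_def by blast+
  let ?Z = "\<lambda>z. {s \<in> coord_box K R. h (s + axis i z) = 0}"
  have finK: "finite (coord_box K R :: (int ^ 'n) set)" and cK: "card (coord_box K R :: (int ^ 'n) set) \<le> M ^ card K"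
    using coord_box_card[OF insert.hyps(1) assms(2)] by (auto simp: M_def)
  have good: "card (?Z z) \<le> 2 * card K * M ^ (card K - 1)" if "z \<notin> bad" for z
    unfolding M_def
  proof (rule insert.IH)
    fix s j
    have "s + axis j y + axis i z = (s + axis i z) + axis j y" for y by simp
    thus "(\<forall>y. h (s + axis j y + axis i z) = 0) \<or> (finite {y. h (s + axis j y + axis i z) = 0}
        \<and> card {y. h (s + axis j y + axis i z) = 0} \<le> 2)"
      using insert.prems(1)[of "s + axis i z" j] by presburger
  next
    show "s1 $ j = 0" if "j \<notin> K" for j
      using that insert.prems(2)[of j] by (auto simp: s1_def axis_def)
    show "h (s1 + axis i z) \<noteq> 0" using that by (simp add: bad_def)
  qed
  have any: "card (?Z z) \<le> M ^ card K" for z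
    using card_mono[OF finK, of "?Z z"] cK by fastforce
  have "{s \<in> coord_box (insert i K) R. h s = 0} \<subseteq> (\<Union>z\<in>{-R..R}. (\<lambda>s. s + axis i z) ` ?Z z)"
    using coord_box_insert[OF insert.hyps(2), of R] by fastforce
  moreover have fin: "finite (\<Union>z\<in>{-R..R}. (\<lambda>s. s + axis i z) ` ?Z z)" using finK by simp
  ultimately have "card {s \<in> coord_box (insert i K) R. h s = 0} \<le> card (\<Union>z\<in>{-R..R}. (\<lambda>s. s + axis i z) ` ?Z z)"
    by (intro card_mono)
  also have "\<dots> \<le> (\<Sum>z\<in>{-R..R}. card ((\<lambda>s. s + axis i z) ` ?Z z))" by (rule card_UN_le) simp
  also have "\<dots> \<le> (\<Sum>z\<in>{-R..R}. card (?Z z))" using finK by (intro sum_mono card_image_le) simp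
  also have "\<dots> \<le> (\<Sum>z\<in>{-R..R}. (if z \<in> bad then M ^ card K else 0) + 2 * card K * M ^ (card K - 1))"
    using good any by (intro sum_mono) (auto intro: trans_le_add1)
  also have "\<dots> = card ({-R..R} \<inter> bad) * M ^ card K + M * (2 * card K * M ^ (card K - 1))"
    using assms(2) by (simp add: sum.distrib sum.If_cases M_def add.commute)
  also have "card ({-R..R} \<inter> bad) \<le> 2"
    using bad card_mono[of bad "{-R..R} \<inter> bad"] by simp
  \<comment> \<open>For empty \<open>K\<close> the factor \<open>card K\<close> makes both sides 0,
    so the truncated exponent does no harm.\<close>
  also have "M * (2 * card K * M ^ (card K - 1)) = 2 * card K * M ^ card K"
    by (cases "card K") (simp_all add: algebra_simps)
  finally show ?case using insert.hyps by (simp add: M_def algebra_simps)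
qed

section \<open>Conics without a uniform bound\<close>

text \<open>The conic is a pair of conjugate lines over a quadratic field, and their intersection is
  the only possible rational point. Concretely, the equation becomes
  \<open>Y * Y = D * (X * X)\<close> with \<open>X\<close>, \<open>Y\<close> of degree 1 in
  \<open>x\<close>, \<open>y\<close>, which forces \<open>X = Y = 0\<close>.\<close>

lemma degenerate_conic_single:
  fixes a b c d e g N :: int
  assumes a: "a \<noteq> 0" and D: "b * b - a * c \<noteq> 0" and nosq: "\<And>m. m * m \<noteq> b * b - a * c"
    and \<Delta>: "2 * b * d * e - a * e * e - c * d * d - (b * b - a * c) * g = 0"
  shows "card {(x, y). a * x * x + 2 * b * x * y + c * y * y + 2 * d * x + 2 * e * y + g = 0 \<and> \<bar>x\<bar> \<le> N \<and> \<bar>y\<bar> \<le> N} \<le> 1"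
proof -
  define D E where "D = b * b - a * c" and "E = b * d - a * e"
  have sol: "a * x + b * y + d = 0" "D * y + E = 0"
    if eq: "a * x * x + 2 * b * x * y + c * y * y + 2 * d * x + 2 * e * y + g = 0" for x y
  proof -
    define X Y where "X = a * x + b * y + d" and "Y = D * y + E"
    have "Y * Y - D * (X * X) =
        - a * D * (a * x * x + 2 * b * x * y + c * y * y + 2 * d * x + 2 * e * y + g)
        - a * (2 * b * d * e - a * e * e - c * d * d - D * g)"
      unfolding X_def Y_def D_def E_def by algebra
    hence YX: "Y * Y = D * (X * X)" using eq \<Delta> by (simp add: D_def)
    have "X = 0"
    proof (rule ccontr)
      assume X: "X \<noteq> 0"
      have "X ^ 2 dvd Y ^ 2" using YX by (simp add: power2_eq_square)
      hence "X dvd Y" by simp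
      then obtain m where "Y = X * m" by blast
      hence "m * m * (X * X) = D * (X * X)" using YX by (simp add: algebra_simps)
      hence "m * m = D" using X by simp
      thus False using nosq by (simp add: D_def)
    qed
    moreover have "Y = 0" using YX \<open>X = 0\<close> by simp
    ultimately show "a * x + b * y + d = 0" "D * y + E = 0" by (simp_all add: X_def Y_def)
  qed
  have uniq: "x = x' \<and> y = y'"
    if "a * x * x + 2 * b * x * y + c * y * y + 2 * d * x + 2 * e * y + g = 0"
      "a * x' * x' + 2 * b * x' * y' + c * y' * y' + 2 * d * x' + 2 * e * y' + g = 0" for x y x' y'
  proof -
    have "D * y = D * y'" using sol(2)[OF that(1)] sol(2)[OF that(2)] by linarith
    hence y: "y = y'" using D by (simp add: D_def)
    have "a * x = a * x'" using sol(1)[OF that(1)] sol(1)[OF that(2)] unfolding y by linarith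
    thus ?thesis using a y by simp
  qed
  define S where "S = {(x, y). a * x * x + 2 * b * x * y + c * y * y + 2 * d * x + 2 * e * y + g = 0 \<and> \<bar>x\<bar> \<le> N \<and> \<bar>y\<bar> \<le> N}"
  have "finite S" by (rule finite_subset[of _ "{-N..N} \<times> {-N..N}"]) (auto simp: S_def)
  moreover have "p = q" if p: "p \<in> S" and q: "q \<in> S" for p q
  proof -
    obtain x y x' y' where "p = (x, y)" "q = (x', y')" by (cases p, cases q)
    thus ?thesis using uniq[of x y x' y'] p q by (simp add: S_def)
  qed
  ultimately have "card S \<le> Suc 0" by (subst card_le_Suc0_iff_eq) blast+
  thus ?thesis by (simp add: S_def)
qed

lemma conic_card_le_linear:
  fixes a b c d e g N :: int
  assumes a: "a \<noteq> 0" and N: "N \<ge> 0"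
  shows "card {(x, y). a * x * x + 2 * b * x * y + c * y * y + 2 * d * x + 2 * e * y + g = 0 \<and> \<bar>x\<bar> \<le> N \<and> \<bar>y\<bar> \<le> N}
    \<le> 2 * nat (2 * N + 1)"
proof -
  define S where "S = {(x, y). a * x * x + 2 * b * x * y + c * y * y + 2 * d * x + 2 * e * y + g = 0 \<and> \<bar>x\<bar> \<le> N \<and> \<bar>y\<bar> \<le> N}"
  have "card S \<le> 2 * card {-N..N}"
  proof (rule card_le_fibres[where f = snd])
    show "finite S" by (rule finite_subset[of _ "{-N..N} \<times> {-N..N}"]) (auto simp: S_def)
    fix y
    define Z where "Z = {x. a * x * x + (2 * b * y + 2 * d) * x + (c * y * y + 2 * e * y + g) = 0}"
    have "\<not> (\<forall>x. a * x * x + (2 * b * y + 2 * d) * x + (c * y * y + 2 * e * y + g) = 0)"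
    proof
      assume *: "\<forall>x. a * x * x + (2 * b * y + 2 * d) * x + (c * y * y + 2 * e * y + g) = 0"
      from *[rule_format, of 0] *[rule_format, of 1] *[rule_format, of "-1"] show False using a by simp
    qed
    hence Z: "finite Z" "card Z \<le> 2" using quadratic_roots_int unfolding Z_def by blast+
    have "card {p \<in> S. snd p = y} \<le> card Z"
      by (rule card_inj_on_le[of fst])
        (use Z in \<open>auto intro!: inj_onI simp: S_def Z_def prod_eq_iff algebra_simps\<close>)
    thus "card {p \<in> S. snd p = y} \<le> 2" using Z by linarith
  qed (auto simp: S_def)
  thus ?thesis using N by (simp add: S_def)
qed

subsection \<open>Slicing by conics\<close>

text \<open>Cramer's rule: a minor equal to 1 or -1 is its own inverse, so integral multiples of
  \<open>u\<close> and \<open>v\<close> clear the entries \<open>k\<close> and \<open>l\<close> of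
  \<open>t\<close>. The entries of \<open>s\<close> are then at most
  \<open>N + 2 * N + 2 * N\<close>.\<close>

lemma unit_minor_decomposition:
  fixes u v t :: "int ^ 'n::finite"
  assumes u: "\<And>i. u $ i \<in> {0, 1}" and v: "\<And>i. v $ i \<in> {0, 1}"
    and minor: "\<bar>u $ k * v $ l - u $ l * v $ k\<bar> = 1"
    and t: "\<And>i. \<bar>t $ i\<bar> \<le> N"
  shows "\<exists>s x y. t = s + x *s u + y *s v \<and> s \<in> coord_box (- {k, l}) (5 * N) \<and> \<bar>x\<bar> \<le> 2 * N \<and> \<bar>y\<bar> \<le> 2 * N"
proof -
  define \<sigma> where "\<sigma> = u $ k * v $ l - u $ l * v $ k"
  define x where "x = \<sigma> * (t $ k * v $ l - t $ l * v $ k)"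
  define y where "y = \<sigma> * (u $ k * t $ l - u $ l * t $ k)"
  define s where "s = t - x *s u - y *s v"
  have "\<bar>\<sigma>\<bar> = 1" using minor by (simp add: \<sigma>_def)
  hence \<sigma>: "\<sigma> * \<sigma> = 1" "\<bar>\<sigma>\<bar> = 1" by (metis abs_mult_self_eq mult_1, assumption)
  have N: "N \<ge> 0" using t[of k] by linarith
  have mult01: "\<bar>p * q\<bar> \<le> M" if "q \<in> {0, 1}" "\<bar>p\<bar> \<le> M" for p q M :: int using that by auto
  have "\<bar>t $ k * v $ l\<bar> \<le> N" "\<bar>t $ l * v $ k\<bar> \<le> N" "\<bar>t $ l * u $ k\<bar> \<le> N" "\<bar>t $ k * u $ l\<bar> \<le> N"
    by (intro mult01 u v t)+
  hence xy: "\<bar>x\<bar> \<le> 2 * N" "\<bar>y\<bar> \<le> 2 * N"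
    unfolding x_def y_def abs_mult[of \<sigma>] \<sigma>(2) by (simp_all add: mult.commute)
  have comp: "s $ i = t $ i - x * u $ i - y * v $ i" for i by (simp add: s_def)
  have "s $ k = t $ k * (1 - \<sigma> * \<sigma>)" "s $ l = t $ l * (1 - \<sigma> * \<sigma>)"
    unfolding comp x_def y_def by (simp_all add: \<sigma>_def algebra_simps)
  moreover have "\<bar>s $ i\<bar> \<le> 5 * N" for i
    using mult01[OF u[of i] xy(1)] mult01[OF v[of i] xy(2)] t[of i] unfolding comp by linarith
  ultimately have "s \<in> coord_box (- {k, l}) (5 * N)" using \<sigma>(1) by (auto simp: coord_box_def)
  moreover have "t = s + x *s u + y *s v" by (simp add: s_def)
  ultimately show ?thesis using xy by blast
qed

section \<open>Integral quadratic maps on slices\<close>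

text \<open>To be instantiated so that \<open>Q\<close> is \<open>2 * q\<close>, with integral
  \<open>B\<close>. The factor 2 before \<open>lin\<close> in \<open>Q\<close> matches the terms
  \<open>2 * d * x\<close> and \<open>2 * e * y\<close> of the conics.\<close>

locale quadratic_map =
  fixes B :: "int ^ 'n::finite \<Rightarrow> int ^ 'n \<Rightarrow> int" and lin :: "int ^ 'n \<Rightarrow> int" and const :: int
  assumes B_add: "B (x + y) z = B x z + B y z"
    and B_scale: "B (r *s x) z = r * B x z"
    and B_sym: "B x y = B y x"
    and lin_add: "lin (x + y) = lin x + lin y"
    and lin_scale: "lin (r *s x) = r * lin x"
begin

definition Q :: "int ^ 'n \<Rightarrow> int" where
  "Q t = B t t + 2 * lin t + const"

text \<open>Minus the Gram determinant: the discriminant \<open>b * b - a * c\<close> of the conic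
  on \<open>s + \<int> u + \<int> v\<close>, the same for every \<open>s\<close>.\<close>

definition gram :: "int ^ 'n \<Rightarrow> int ^ 'n \<Rightarrow> int" where
  "gram u v = B u v * B u v - B u u * B v v"

text \<open>The determinant of the conic cut out by \<open>Q\<close> on \<open>s + \<int> u + \<int> v\<close>.\<close>

definition disc :: "int ^ 'n \<Rightarrow> int ^ 'n \<Rightarrow> int ^ 'n \<Rightarrow> int" where
  "disc u v s = 2 * B u v * (B u s + lin u) * (B v s + lin v)
     - B u u * (B v s + lin v) * (B v s + lin v)
     - B v v * (B u s + lin u) * (B u s + lin u) - gram u v * Q s"

lemma B_add_right: "B z (x + y) = B z x + B z y"
  by (metis B_add B_sym)

lemma B_scale_right: "B z (r *s x) = r * B z x"
  by (metis B_scale B_sym)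

lemmas expand = B_add B_add_right B_scale B_scale_right lin_add lin_scale

lemma Q_slice:
  "Q (s + x *s u + y *s v) = B u u * x * x + 2 * B u v * x * y + B v v * y * y
     + 2 * (B u s + lin u) * x + 2 * (B v s + lin v) * y + Q s"
  unfolding Q_def expand B_sym[of s u] B_sym[of s v] B_sym[of v u] by algebra

lemma disc_slice: "disc u v (s + x *s u + y *s v) = disc u v s"
proof -
  define a b c d e where "a = B u u" and "b = B u v" and "c = B v v"
    and "d = B u s + lin u" and "e = B v s + lin v"
  have 1: "B u (s + x *s u + y *s v) + lin u = a * x + b * y + d"
    unfolding expand a_def b_def d_def by (simp add: algebra_simps)
  have 2: "B v (s + x *s u + y *s v) + lin v = b * x + c * y + e"
    unfolding expand b_def c_def e_def B_sym[of v u] by (simp add: algebra_simps)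
  show ?thesis
    unfolding disc_def 1 2 gram_def Q_slice
    unfolding a_def[symmetric] b_def[symmetric] c_def[symmetric] d_def[symmetric] e_def[symmetric]
    by (rule conic_det_translate)
qed

lemma disc_axis: "\<exists>\<alpha> \<beta> \<gamma>. \<forall>z. disc u v (s + axis i z) = \<alpha> * z * z + \<beta> * z + \<gamma>"
proof -
  define w :: "int ^ 'n" where "w = axis i 1"
  have ax: "axis i z = z *s w" for z by (simp add: w_def vec_eq_iff axis_def)
  define d e d1 e1 g1 g2 where "d = B u s + lin u" and "e = B v s + lin v"
    and "d1 = B u w" and "e1 = B v w" and "g1 = 2 * (B s w + lin w)" and "g2 = B w w"
  have "disc u v (s + axis i z) =
      (2 * B u v * d1 * e1 - B u u * e1 * e1 - B v v * d1 * d1 - gram u v * g2) * z * z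
    + (2 * B u v * (d1 * e + e1 * d) - 2 * B u u * e1 * e - 2 * B v v * d1 * d - gram u v * g1) * z
    + disc u v s" for z
  proof -
    have 1: "B u (s + axis i z) + lin u = d + z * d1" "B v (s + axis i z) + lin v = e + z * e1"
      unfolding ax expand d_def e_def d1_def e1_def by simp_all
    have 2: "Q (s + axis i z) = Q s + g1 * z + g2 * z * z"
      unfolding Q_def ax expand g1_def g2_def B_sym[of w s] by algebra
    show ?thesis
      unfolding disc_def 1 2 d_def[symmetric] e_def[symmetric] by algebra
  qed
  thus ?thesis by blast
qed

lemma disc_axis_zeros:
  "(\<forall>z. disc u v (s + axis i z) = 0) \<or>
    (finite {z. disc u v (s + axis i z) = 0} \<and> card {z. disc u v (s + axis i z) = 0} \<le> 2)"
proof -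
  obtain \<alpha> \<beta> \<gamma> where *: "\<And>z. disc u v (s + axis i z) = \<alpha> * z * z + \<beta> * z + \<gamma>"
    using disc_axis by blast
  show ?thesis unfolding * by (rule quadratic_roots_int)
qed

lemma unit_minor:
  assumes u: "\<And>i. u $ i \<in> {0, 1}" and v: "\<And>i. v $ i \<in> {0, 1}" and gram: "gram u v \<noteq> 0"
  obtains k l where "\<bar>u $ k * v $ l - u $ l * v $ k\<bar> = 1"
proof -
  have "\<exists>k l. u $ k * v $ l - u $ l * v $ k \<noteq> 0"
  proof (rule ccontr)
    assume "\<nexists>k l. u $ k * v $ l - u $ l * v $ k \<noteq> 0"
    hence par: "u $ k * v $ l = u $ l * v $ k" for k l by auto
    have "u \<noteq> 0"
    proof
      assume "u = 0"
      hence "u = 0 *s v" by (simp add: vec_eq_iff)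
      hence "gram u v = 0" unfolding gram_def by (metis B_scale mult_zero_left diff_self)
      thus False using gram by simp
    qed
    then obtain k where "u $ k \<noteq> 0" by (auto simp: vec_eq_iff)
    hence uk: "u $ k = 1" using u[of k] by simp
    define r where "r = v $ k"
    have "v $ i = r * u $ i" for i unfolding r_def using par[of k i] unfolding uk by (simp only: mult_1 mult.commute)
    hence "v = r *s u" unfolding vec_eq_iff by simp
    moreover have "gram u (r *s u) = 0" for r unfolding gram_def expand by simp
    ultimately have "gram u v = 0" by metis
    thus False using gram by simp
  qed
  then obtain k l where kl: "u $ k * v $ l - u $ l * v $ k \<noteq> 0" by blast
  hence "\<bar>u $ k * v $ l - u $ l * v $ k\<bar> = 1"
    using u[of k] u[of l] v[of k] v[of l] by auto
  thus ?thesis by (rule that)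
qed

text \<open>The power of \<open>10 * N + 1\<close> counts slices, and \<open>F\<close> bounds a
  nondegenerate one. The 1 is for degenerate slices with nonsquare discriminant. The last summand is
  for square discriminant: at most \<open>2 * card K * M ^ (card K - 1)\<close> degenerate slices
  with at most \<open>2 * M\<close> points each.\<close>

lemma zeros_card_le:
  fixes F :: real
  assumes u: "\<And>i. u $ i \<in> {0, 1}" and v: "\<And>i. v $ i \<in> {0, 1}"
    and a: "B u u \<noteq> 0" and gram: "gram u v \<noteq> 0"
    and irred: "\<And>m. m * m = gram u v \<Longrightarrow> \<exists>s. disc u v s \<noteq> 0"
    and N: "N \<ge> 1"
    and conic: "\<And>a b c d e g :: int. b * b - a * c \<noteq> 0 \<Longrightarrow>
      2 * b * d * e - a * e * e - c * d * d - (b * b - a * c) * g \<noteq> 0 \<Longrightarrow>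
      real (card {(x, y). a * x * x + 2 * b * x * y + c * y * y + 2 * d * x + 2 * e * y + g = 0 \<and> \<bar>x\<bar> \<le> 2 * N \<and> \<bar>y\<bar> \<le> 2 * N}) \<le> F"
  shows "real (card {t. (\<forall>i. \<bar>t $ i\<bar> \<le> N) \<and> Q t = 0})
    \<le> real_of_int (10 * N + 1) ^ (CARD('n) - 2) * (F + 1 + 4 * real CARD('n))"
proof -
  obtain k l where kl: "\<bar>u $ k * v $ l - u $ l * v $ k\<bar> = 1" using unit_minor[OF u v gram] .
  define K where "K = - {k, l}"
  define S where "S = coord_box K (5 * N)"
  define M where "M = nat (10 * N + 1)"
  define E where "E = (\<lambda>s. {(x, y). B u u * x * x + 2 * B u v * x * y + B v v * y * y
     + 2 * (B u s + lin u) * x + 2 * (B v s + lin v) * y + Q s = 0 \<and> \<bar>x\<bar> \<le> 2 * N \<and> \<bar>y\<bar> \<le> 2 * N})"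
  define Z where "Z = {s \<in> S. disc u v s = 0}"
  have "k \<noteq> l" using kl by auto
  hence cardK: "card K = CARD('n) - 2"
    by (simp add: K_def Compl_eq_Diff_UNIV card_Diff_subset)
  have S: "finite S" "card S \<le> M ^ card K"
    using coord_box_card[of K "5 * N"] N by (simp_all add: S_def M_def)
  have finE: "finite (E s)" for s
    by (rule finite_subset[of _ "{-(2*N)..2*N} \<times> {-(2*N)..2*N}"]) (auto simp: E_def)
  \<comment> \<open>Any admissible instance of \<open>conic\<close> will do, since it bounds a
    cardinality by \<open>F\<close>.\<close>
  have F0: "F \<ge> 0" using conic[of 0 1 1 0 0 1] by (simp add: order_trans[OF of_nat_0_le_iff])
  have sub: "{t. (\<forall>i. \<bar>t $ i\<bar> \<le> N) \<and> Q t = 0} \<subseteq> (\<Union>s\<in>S. (\<lambda>p. s + fst p *s u + snd p *s v) ` E s)"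
  proof
    fix t assume "t \<in> {t. (\<forall>i. \<bar>t $ i\<bar> \<le> N) \<and> Q t = 0}"
    hence t: "\<And>i. \<bar>t $ i\<bar> \<le> N" "Q t = 0" by auto
    obtain s x y where sxy: "t = s + x *s u + y *s v" "s \<in> S" "\<bar>x\<bar> \<le> 2 * N" "\<bar>y\<bar> \<le> 2 * N"
      using unit_minor_decomposition[OF u v kl t(1)] unfolding S_def K_def by blast
    hence "(x, y) \<in> E s" using t(2) Q_slice[of s x u y v] by (simp add: E_def)
    thus "t \<in> (\<Union>s\<in>S. (\<lambda>p. s + fst p *s u + snd p *s v) ` E s)" using sxy by force
  qed
  have "card {t. (\<forall>i. \<bar>t $ i\<bar> \<le> N) \<and> Q t = 0} \<le> card (\<Union>s\<in>S. (\<lambda>p. s + fst p *s u + snd p *s v) ` E s)"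
    using sub S finE by (intro card_mono) auto
  also have "\<dots> \<le> (\<Sum>s\<in>S. card ((\<lambda>p. s + fst p *s u + snd p *s v) ` E s))"
    using S(1) by (rule card_UN_le)
  also have "\<dots> \<le> (\<Sum>s\<in>S. card (E s))"
    using finE by (intro sum_mono card_image_le)
  finally have "real (card {t. (\<forall>i. \<bar>t $ i\<bar> \<le> N) \<and> Q t = 0}) \<le> (\<Sum>s\<in>S. real (card (E s)))"
    unfolding of_nat_sum[symmetric] by (rule of_nat_mono)
  also have "\<dots> \<le> (\<Sum>s\<in>S. (F + 1) + (if s \<in> Z \<and> (\<exists>m. m * m = gram u v) then 2 * real M else 0))"
  proof (rule sum_mono)
    fix s assume s: "s \<in> S"
    consider "s \<notin> Z" | "s \<in> Z" "\<nexists>m. m * m = gram u v" | "s \<in> Z" "\<exists>m. m * m = gram u v" by blast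
    thus "real (card (E s)) \<le> (F + 1) + (if s \<in> Z \<and> (\<exists>m. m * m = gram u v) then 2 * real M else 0)"
    proof cases
      case 1
      have "real (card (E s)) \<le> F" unfolding E_def
        by (rule conic) (use 1 s gram in \<open>auto simp: Z_def disc_def gram_def\<close>)
      thus ?thesis using 1 by simp
    next
      case 2
      have "card (E s) \<le> 1" unfolding E_def
        by (rule degenerate_conic_single) (use 2 a gram in \<open>auto simp: Z_def disc_def gram_def\<close>)
      thus ?thesis using 2 F0 by simp
    next
      case 3
      have "card (E s) \<le> 2 * nat (2 * (2 * N) + 1)" unfolding E_def
        using N by (intro conic_card_le_linear a) simp
      also have "\<dots> \<le> 2 * M" using N by (simp add: M_def)
      finally show ?thesis using 3 F0 by simp
    qed
  qed
  also have "\<dots> = real (card S) * (F + 1) + (if \<exists>m. m * m = gram u v then real (card Z) * (2 * real M) else 0)"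
    using S(1) by (simp add: sum.distrib sum.If_cases Z_def Int_def)
  also have "\<dots> \<le> real (M ^ card K) * (F + 1) + real (M ^ card K) * (4 * real CARD('n))"
  proof (intro add_mono mult_right_mono)
    show "(if \<exists>m. m * m = gram u v then real (card Z) * (2 * real M) else 0) \<le> real (M ^ card K) * (4 * real CARD('n))"
    proof (cases "\<exists>m. m * m = gram u v")
      case True
      then obtain s where s: "disc u v s \<noteq> 0" using irred by blast
      \<comment> \<open>The witness \<open>s\<close> is moved along its slice to a vector vanishing
        at \<open>k\<close> and \<open>l\<close>, which does not change \<open>disc\<close>.
        \<open>N'\<close> is whatever size is needed, as only the support of \<open>s0\<close>
        matters.\<close>
      define N' where "N' = Max (range (\<lambda>i. \<bar>s $ i\<bar>))"
      have "\<bar>s $ i\<bar> \<le> N'" for i unfolding N'_def by (rule Max_ge) auto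
      then obtain s0 x y where s0: "s = s0 + x *s u + y *s v" "s0 \<in> coord_box (- {k, l}) (5 * N')"
        using unit_minor_decomposition[OF u v kl] by blast
      have "card Z \<le> 2 * card K * nat (2 * (5 * N) + 1) ^ (card K - 1)"
        unfolding Z_def S_def
      proof (rule coord_box_zeros[where ?s0.0 = s0])
        show "disc u v s0 \<noteq> 0" using s s0(1) disc_slice by simp
        show "s0 $ i = 0" if "i \<notin> K" for i using that s0(2) by (auto simp: K_def coord_box_def)
      qed (use N disc_axis_zeros in auto)
      hence "card Z * (2 * M) \<le> 2 * card K * M ^ (card K - 1) * (2 * M)"
        unfolding M_def by (intro mult_right_mono) auto
      also have "\<dots> = M ^ card K * (4 * card K)" by (cases "card K") (simp_all add: algebra_simps)
      also have "\<dots> \<le> M ^ card K * (4 * CARD('n))" using cardK by simp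
      finally have "real (card Z * (2 * M)) \<le> real (M ^ card K * (4 * CARD('n)))" by (rule of_nat_mono)
      thus ?thesis using True by simp
    qed simp
  qed (use S F0 in auto)
  also have "\<dots> = real_of_int (10 * N + 1) ^ (CARD('n) - 2) * (F + 1 + 4 * real CARD('n))"
    using N by (simp add: M_def cardK algebra_simps)
  finally show ?thesis .
qed

end

subsection \<open>Polynomials of degree at most two\<close>

definition eval_monom :: "('n::finite \<Rightarrow>\<^sub>0 nat) \<Rightarrow> 'a::comm_semiring_1 ^ 'n \<Rightarrow> 'a" where
  "eval_monom m x = (\<Prod>i\<in>UNIV. (x $ i) ^ Poly_Mapping.lookup m i)"

lemma eval_monom_add: "eval_monom (m + n) x = eval_monom m x * eval_monom n x"
  by (simp add: eval_monom_def lookup_add power_add prod.distrib)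

lemma eval_monom_0 [simp]: "eval_monom 0 x = 1"
  by (simp add: eval_monom_def)

lemma eval_monom_single [simp]: "eval_monom (Poly_Mapping.single i 1) x = x $ i"
proof -
  have "eval_monom (Poly_Mapping.single i 1) x = (\<Prod>j\<in>UNIV. if j = i then x $ i else 1)"
    unfolding eval_monom_def by (intro prod.cong) (auto simp: lookup_single when_def)
  thus ?thesis by simp
qed

lemma eval_mpoly_superset:
  assumes "finite S" "Poly_Mapping.keys p \<subseteq> S"
  shows "eval_mpoly p x = (\<Sum>m\<in>S. Poly_Mapping.lookup p m * eval_monom m x)"
  unfolding eval_mpoly_def eval_monom_def using assms
  by (intro sum.mono_neutral_left) (auto simp: in_keys_iff)

lemma eval_mpoly_add: "eval_mpoly (p + q) x = eval_mpoly p x + eval_mpoly q x"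
proof -
  let ?S = "Poly_Mapping.keys p \<union> Poly_Mapping.keys q"
  have "eval_mpoly (p + q) x = (\<Sum>m\<in>?S. Poly_Mapping.lookup (p + q) m * eval_monom m x)"
    by (rule eval_mpoly_superset) (simp, rule Poly_Mapping.keys_add)
  moreover have "eval_mpoly p x = (\<Sum>m\<in>?S. Poly_Mapping.lookup p m * eval_monom m x)"
    "eval_mpoly q x = (\<Sum>m\<in>?S. Poly_Mapping.lookup q m * eval_monom m x)"
    by (rule eval_mpoly_superset; simp)+
  ultimately show ?thesis by (simp add: lookup_add distrib_right sum.distrib)
qed

lemma eval_mpoly_0 [simp]: "eval_mpoly 0 x = 0"
  by (simp add: eval_mpoly_def)

lemma eval_mpoly_sum: "eval_mpoly (sum f A) x = (\<Sum>a\<in>A. eval_mpoly (f a) x)"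
  by (induction A rule: infinite_finite_induct) (auto simp: eval_mpoly_add)

lemma eval_mpoly_single: "eval_mpoly (Poly_Mapping.single m a) x = a * eval_monom m x"
  by (subst eval_mpoly_superset[of "{m}"]) auto

lemma mpoly_sum_single: "p = (\<Sum>m\<in>Poly_Mapping.keys p. Poly_Mapping.single m (Poly_Mapping.lookup p m))"
  by (rule poly_mapping_eqI)
    (auto simp: lookup_sum lookup_single when_def in_keys_iff)

lemma eval_mpoly_mult: "eval_mpoly (p * q) x = eval_mpoly p x * eval_mpoly q x"
proof -
  have eval: "eval_mpoly r x = (\<Sum>m\<in>Poly_Mapping.keys r. Poly_Mapping.lookup r m * eval_monom m x)" for r
    by (rule eval_mpoly_superset) simp_all
  have single: "eval_mpoly (Poly_Mapping.single m a * q) x = a * eval_monom m x * eval_mpoly q x" for m a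
  proof -
    have "Poly_Mapping.single m a * q =
        (\<Sum>n\<in>Poly_Mapping.keys q. Poly_Mapping.single (m + n) (a * Poly_Mapping.lookup q n))"
      by (subst mpoly_sum_single[of q]) (simp add: sum_distrib_left mult_single)
    thus ?thesis
      by (simp add: eval_mpoly_sum eval_mpoly_single eval_monom_add eval[of q] sum_distrib_left mult_ac)
  qed
  have "p * q = (\<Sum>m\<in>Poly_Mapping.keys p. Poly_Mapping.single m (Poly_Mapping.lookup p m) * q)"
    by (subst mpoly_sum_single[of p]) (simp add: sum_distrib_right)
  thus ?thesis by (simp add: eval_mpoly_sum single eval[of p] sum_distrib_right)
qed

lemma eval_mpoly_1 [simp]: "eval_mpoly 1 x = 1"
  by (simp add: eval_mpoly_single flip: single_one)

text \<open>A zero certifies a nonunit without any recourse to degrees of products.\<close>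

lemma not_dvd_one_if_root: "eval_mpoly p x = 0 \<Longrightarrow> \<not> p dvd (1 :: ('n::finite, 'a::comm_ring_1) mpoly)"
  by (metis dvdE eval_mpoly_1 eval_mpoly_mult mult_zero_left zero_neq_one)

abbreviation var :: "'n \<Rightarrow> 'n \<Rightarrow>\<^sub>0 nat" where
  "var i \<equiv> Poly_Mapping.single i 1"

text \<open>\<open>M\<close> need not be symmetric, so that a product of two linear polynomials has
  this form with the matrix \<open>b i * b' j\<close>. The price is that different \<open>M\<close>
  may give the same polynomial.\<close>

definition quad_mpoly :: "('n \<Rightarrow> 'n \<Rightarrow> 'a) \<Rightarrow> ('n \<Rightarrow> 'a) \<Rightarrow> 'a \<Rightarrow> ('n::finite, 'a::comm_ring_1) mpoly" where
  "quad_mpoly M b c = (\<Sum>i\<in>UNIV. \<Sum>j\<in>UNIV. Poly_Mapping.single (var i + var j) (M i j))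
     + (\<Sum>i\<in>UNIV. Poly_Mapping.single (var i) (b i)) + Poly_Mapping.single 0 c"

definition lin_mpoly :: "('n \<Rightarrow> 'a) \<Rightarrow> 'a \<Rightarrow> ('n::finite, 'a::comm_ring_1) mpoly" where
  "lin_mpoly b c = (\<Sum>i\<in>UNIV. Poly_Mapping.single (var i) (b i)) + Poly_Mapping.single 0 c"

lemma eval_quad_mpoly:
  "eval_mpoly (quad_mpoly M b c) x = (\<Sum>i\<in>UNIV. \<Sum>j\<in>UNIV. M i j * (x $ i * x $ j)) + (\<Sum>i\<in>UNIV. b i * x $ i) + c"
  by (simp add: quad_mpoly_def eval_mpoly_add eval_mpoly_sum eval_mpoly_single eval_monom_add del: One_nat_def)

lemma eval_lin_mpoly: "eval_mpoly (lin_mpoly b c) x = (\<Sum>i\<in>UNIV. b i * x $ i) + c"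
  by (simp add: lin_mpoly_def eval_mpoly_add eval_mpoly_sum eval_mpoly_single del: One_nat_def)

lemma lin_mpoly_mult:
  "lin_mpoly b c * lin_mpoly b' c' = quad_mpoly (\<lambda>i j. b i * b' j) (\<lambda>i. b i * c' + c * b' i) (c * c')"
proof -
  define X where "X = (\<lambda>b :: 'a \<Rightarrow> 'b. \<Sum>i\<in>UNIV. Poly_Mapping.single (var i) (b i))"
  have "X b * X b' = (\<Sum>i\<in>UNIV. \<Sum>j\<in>UNIV. Poly_Mapping.single (var i + var j) (b i * b' j))"
    unfolding X_def sum_product mult_single ..
  moreover have "X b * Poly_Mapping.single 0 c' = X (\<lambda>i. b i * c')"
    unfolding X_def sum_distrib_right mult_single by simp
  moreover have "Poly_Mapping.single 0 c * X b' = X (\<lambda>i. c * b' i)"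
    unfolding X_def sum_distrib_left mult_single by simp
  moreover have "X (\<lambda>i. b i * c' + c * b' i) = X (\<lambda>i. b i * c') + X (\<lambda>i. c * b' i)"
    unfolding X_def single_add sum.distrib ..
  moreover have lin: "lin_mpoly f r = X f + Poly_Mapping.single 0 r" for f r
    by (simp only: X_def lin_mpoly_def)
  moreover have "quad_mpoly M f r = (\<Sum>i\<in>UNIV. \<Sum>j\<in>UNIV. Poly_Mapping.single (var i + var j) (M i j))
      + X f + Poly_Mapping.single 0 r" for M f r
    by (simp only: X_def quad_mpoly_def)
  ultimately show ?thesis by (simp only: distrib_left distrib_right mult_single add_0_left add_ac)
qed

lemma quad_mpoly_diff:
  "quad_mpoly M b c - quad_mpoly M' b' c' = quad_mpoly (\<lambda>i j. M i j - M' i j) (\<lambda>i. b i - b' i) (c - c')"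
  unfolding quad_mpoly_def by (simp add: single_diff sum_subtractf algebra_simps del: One_nat_def)

lemma sum_axis: "(\<Sum>i\<in>UNIV. f i * axis k x $ i) = f k * (x :: 'a::comm_ring_1)"
proof -
  have "(\<Sum>i\<in>UNIV. f i * axis k x $ i) = (\<Sum>i\<in>UNIV. if i = k then f k * x else 0)"
    by (intro sum.cong) (auto simp: axis_def)
  thus ?thesis by simp
qed

lemma double_sum_axis:
  "(\<Sum>i\<in>UNIV. \<Sum>j\<in>UNIV. M i j * (axis k x $ i * axis l y $ j)) = M k l * x * (y :: 'a::comm_ring_1)"
proof -
  have "(\<Sum>i\<in>UNIV. \<Sum>j\<in>UNIV. M i j * (axis k x $ i * axis l y $ j)) =
      (\<Sum>i\<in>UNIV. (\<Sum>j\<in>UNIV. M i j * axis l y $ j) * axis k x $ i)"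
    by (simp add: sum_distrib_left mult_ac)
  also have "\<dots> = (\<Sum>i\<in>UNIV. (M i l * y) * axis k x $ i)" by (simp only: sum_axis)
  also have "\<dots> = M k l * x * y" unfolding sum_axis by (simp only: mult_ac)
  finally show ?thesis .
qed

text \<open>Points with at most two nonzero coordinates suffice. They show only that
  \<open>M\<close> is skew-symmetric, which is enough because \<open>(i, j)\<close> and
  \<open>(j, i)\<close> belong to the same monomial.\<close>

lemma quad_mpoly_eq_0:
  fixes M :: "'n::finite \<Rightarrow> 'n \<Rightarrow> rat"
  assumes "\<And>s :: int ^ 'n. eval_mpoly (quad_mpoly M b c) (\<chi> i. of_int (s $ i)) = 0"
  shows "quad_mpoly M b c = 0"
proof -
  define f where "f = (\<lambda>x :: rat ^ 'n. (\<Sum>i\<in>UNIV. \<Sum>j\<in>UNIV. M i j * (x $ i * x $ j)) + (\<Sum>i\<in>UNIV. b i * x $ i) + c)"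
  have f0: "f (axis k (of_int x) + axis l (of_int y)) = 0" for k l and x y :: int
  proof -
    have "(\<chi> i. of_int ((axis k x + axis l y) $ i)) = (axis k (of_int x) + axis l (of_int y) :: rat ^ 'n)"
      by (auto simp: vec_eq_iff axis_def)
    thus ?thesis using assms[of "axis k x + axis l y"] by (simp add: f_def eval_quad_mpoly)
  qed
  have fval: "f (axis k x + axis l y) = M k k * x * x + M k l * x * y + M l k * y * x + M l l * y * y + b k * x + b l * y + c" for k l x y
    unfolding f_def
    by (simp add: distrib_left distrib_right sum.distrib double_sum_axis sum_axis)
  have eq: "M k k * of_int x * of_int x + M k l * of_int x * of_int y + M l k * of_int y * of_int x
      + M l l * of_int y * of_int y + b k * of_int x + b l * of_int y + c = 0" for k l and x y :: int
    using f0[of k x l y] unfolding fval .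
  \<comment> \<open>At the origin only \<open>c\<close> survives, whichever index
    \<open>undefined\<close> denotes.\<close>
  have c: "c = 0" using eq[of undefined 0 undefined 0] by simp
  have b: "b k = 0" and diag: "M k k = 0" for k
    using eq[of k 1 k 0] eq[of k "-1" k 0] c by simp_all
  have skew: "M j i = - M i j" for i j
    using eq[of i 1 j 1] b diag c by (simp add: eq_neg_iff_add_eq_0 add.commute)
  define X where "X = (\<Sum>i\<in>UNIV. \<Sum>j\<in>UNIV. Poly_Mapping.single (var i + var j) (M i j))"
  have "X = (\<Sum>i\<in>UNIV. \<Sum>j\<in>UNIV. Poly_Mapping.single (var j + var i) (M j i))"
    unfolding X_def by (rule sum.swap)
  also have "\<dots> = - X"
  proof -
    have "Poly_Mapping.single (var j + var i) (M j i) = - Poly_Mapping.single (var i + var j) (M i j)" for i j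
      unfolding skew[of j i] single_uminus by (simp add: add.commute)
    thus ?thesis unfolding X_def sum_negf[symmetric] by (intro sum.cong refl)
  qed
  finally have "X = - X" .
  hence "Poly_Mapping.lookup X m = - Poly_Mapping.lookup X m" for m by (metis lookup_uminus)
  hence "X = 0" by (intro poly_mapping_eqI) simp
  thus ?thesis using b c by (simp add: quad_mpoly_def X_def)
qed

section \<open>Coefficients of polynomials of degree at most two\<close>

lemma monom_degree_add: "monom_degree (m + n) = monom_degree m + monom_degree n"
  by (simp add: monom_degree_def lookup_add sum.distrib)

lemma monom_degree_single [simp]: "monom_degree (Poly_Mapping.single i k) = k"
proof -
  have "monom_degree (Poly_Mapping.single i k) = (\<Sum>j\<in>UNIV. if j = i then k else 0)"
    unfolding monom_degree_def by (intro sum.cong) (auto simp: lookup_single when_def)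
  thus ?thesis by simp
qed

lemma monom_degree_0 [simp]: "monom_degree 0 = 0"
  by (simp add: monom_degree_def)

lemma monom_split:
  assumes "m \<noteq> 0"
  obtains i m' where "m = var i + m'"
proof -
  obtain i where i: "Poly_Mapping.lookup m i \<noteq> 0" using assms by (metis poly_mapping_eqI lookup_zero)
  have "m = var i + (m - var i)"
    by (rule poly_mapping_eqI) (use i in \<open>auto simp: lookup_add lookup_minus lookup_single when_def\<close>)
  thus ?thesis by (rule that)
qed

lemma monom_degree_le_2_cases:
  assumes "monom_degree m \<le> 2"
  obtains "m = 0" | i where "m = var i" | i j where "m = var i + var j"
proof (cases "m = 0")
  case False
  then obtain i m1 where m1: "m = var i + m1" by (rule monom_split)
  show ?thesis
  proof (cases "m1 = 0")
    case False
    then obtain j m2 where m2: "m1 = var j + m2" by (rule monom_split)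
    have "monom_degree m2 = 0" using assms by (simp add: m1 m2 monom_degree_add)
    hence "m2 = 0" by (intro poly_mapping_eqI) (simp add: monom_degree_def)
    thus ?thesis using m1 m2 that(3)[of i j] by simp
  qed (use m1 that(2) in simp)
qed (rule that(1))

lemma var_add_eq_iff: "var i + var j = var k + var l \<longleftrightarrow> (i = k \<and> j = l) \<or> (i = l \<and> j = k)"
proof
  assume eq: "var i + var j = var k + var l"
  have count: "(if i = x then 1 else 0) + (if j = x then 1 else 0 :: nat) = (if k = x then 1 else 0) + (if l = x then 1 else 0)" for x
    using arg_cong[OF eq, of "\<lambda>m. Poly_Mapping.lookup m x"] by (simp only: lookup_add lookup_single when_def)
  show "(i = k \<and> j = l) \<or> (i = l \<and> j = k)"
  proof (cases "i = k")
    case True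
    thus ?thesis using count[of j] by (simp split: if_splits)
  next
    case False
    have "l = i" using count[of i] False by (simp split: if_splits)
    moreover have "k = j" using count[of j] \<open>l = i\<close> by (simp split: if_splits)
    ultimately show ?thesis by simp
  qed
qed (auto simp: add.commute)

lemma var_eq_iff: "var i = var k \<longleftrightarrow> i = k"
  by (metis lookup_single_eq lookup_single_not_eq one_neq_zero)

lemma lookup_eq_0_if_degree:
  assumes "total_degree p \<le> d" "monom_degree m > d"
  shows "Poly_Mapping.lookup p m = 0"
proof (rule ccontr)
  assume "Poly_Mapping.lookup p m \<noteq> 0"
  hence "monom_degree m \<le> total_degree p"
    unfolding total_degree_def by (intro Max_ge) (auto simp: in_keys_iff)
  thus False using assms by simp
qed

lemma lookup_quadratic_part:
  "monom_degree m = 2 \<Longrightarrow> Poly_Mapping.lookup (quadratic_part p) m = Poly_Mapping.lookup p m"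
  by (simp add: hom_component_def lookup_mapp when_def in_keys_iff)

lemma form_matrix_quadratic_part:
  "form_matrix (quadratic_part p) $ i $ j =
     (if i = j then Poly_Mapping.lookup p (Poly_Mapping.single i 2) else Poly_Mapping.lookup p (var i + var j) / 2)"
  by (simp add: form_matrix_def lookup_quadratic_part monom_degree_add del: One_nat_def)

lemma lookup_quad_mpoly:
  "Poly_Mapping.lookup (quad_mpoly M b c) m =
     (\<Sum>p\<in>UNIV. if var (fst p) + var (snd p) = m then M (fst p) (snd p) else 0)
     + (\<Sum>i\<in>UNIV. if var i = m then b i else 0) + (if m = 0 then c else 0)"
  unfolding quad_mpoly_def
  by (simp add: lookup_add lookup_sum lookup_single when_def sum.cartesian_product case_prod_unfold
      del: One_nat_def)

text \<open>The halved entries off the diagonal compensate for the double sum, which meets each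
  mixed monomial twice.\<close>

lemma quad_mpoly_repr:
  fixes p :: "('n::finite, rat) mpoly"
  assumes deg: "total_degree p \<le> 2"
  shows "p = quad_mpoly (\<lambda>i j. form_matrix (quadratic_part p) $ i $ j)
    (\<lambda>i. Poly_Mapping.lookup p (var i)) (Poly_Mapping.lookup p 0)" (is "p = quad_mpoly ?M ?b ?c")
proof (rule poly_mapping_eqI)
  fix m :: "'n \<Rightarrow>\<^sub>0 nat"
  have deg_ne: "var i + var j \<noteq> m" if "monom_degree m \<noteq> 2" for i j
    using that by (auto simp: monom_degree_add)
  have deg_ne1: "var i \<noteq> m" if "monom_degree m \<noteq> 1" for i
    using that by auto
  have deg_ne0: "m \<noteq> 0" if "monom_degree m \<noteq> 0"
    using that by auto
  show "Poly_Mapping.lookup p m = Poly_Mapping.lookup (quad_mpoly ?M ?b ?c) m"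
  proof (cases "monom_degree m \<le> 2")
    case False
    hence "Poly_Mapping.lookup p m = 0" using deg by (intro lookup_eq_0_if_degree) auto
    thus ?thesis using False deg_ne deg_ne1 deg_ne0 by (simp add: lookup_quad_mpoly del: One_nat_def)
  next
    case True
    thus ?thesis
    proof (cases rule: monom_degree_le_2_cases)
      case 1
      thus ?thesis using deg_ne deg_ne1 by (simp add: lookup_quad_mpoly del: One_nat_def)
    next
      case (2 k)
      have "(\<Sum>i\<in>UNIV. if var i = m then ?b i else 0) = (\<Sum>i\<in>UNIV. if i = k then ?b k else 0)"
        unfolding 2 var_eq_iff by (intro sum.cong) auto
      thus ?thesis using 2 deg_ne deg_ne0 by (simp add: lookup_quad_mpoly del: One_nat_def)
    next
      case (3 k l)
      have dm: "monom_degree m = 2" by (simp add: 3 monom_degree_add)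
      \<comment> \<open>For \<open>k = l\<close> the set of pairs is a singleton, in accordance with
        the diagonal entries, which are not halved.\<close>
      have "(\<Sum>p\<in>UNIV. if var (fst p) + var (snd p) = m then ?M (fst p) (snd p) else 0)
          = (\<Sum>p\<in>UNIV. if p \<in> {(k, l), (l, k)} then ?M (fst p) (snd p) else 0)"
        unfolding 3 var_add_eq_iff by (intro sum.cong) (auto simp: prod_eq_iff)
      also have "\<dots> = (\<Sum>p\<in>{(k, l), (l, k)}. ?M (fst p) (snd p))"
        by (subst sum.inter_restrict[symmetric]) auto
      also have "\<dots> = Poly_Mapping.lookup p m"
        unfolding form_matrix_quadratic_part 3
        by (cases "k = l") (auto simp: add.commute single_add[symmetric] simp del: One_nat_def)
      finally show ?thesis using dm deg_ne1 deg_ne0 by (simp add: lookup_quad_mpoly del: One_nat_def)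
    qed
  qed
qed

lemma lookup_rat_mpoly: "Poly_Mapping.lookup (rat_mpoly q) m = of_int (Poly_Mapping.lookup q m)"
  by (simp add: rat_mpoly_def map.rep_eq when_def)

lemma keys_rat_mpoly: "Poly_Mapping.keys (rat_mpoly q) = Poly_Mapping.keys q"
  by (auto simp: in_keys_iff lookup_rat_mpoly)

lemma total_degree_rat_mpoly: "total_degree (rat_mpoly q) = total_degree q"
  by (simp add: total_degree_def keys_rat_mpoly)

lemma eval_rat_mpoly: "eval_mpoly (rat_mpoly q) (\<chi> i. of_int (s $ i)) = of_int (eval_mpoly q s)"
  by (simp add: eval_mpoly_def keys_rat_mpoly lookup_rat_mpoly)

lemma quadratic_map_forms:
  fixes A :: "'n::finite \<Rightarrow> 'n \<Rightarrow> int"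
  assumes "\<And>i j. A i j = A j i"
  shows "quadratic_map (\<lambda>s t. \<Sum>i\<in>UNIV. \<Sum>j\<in>UNIV. A i j * (s $ i * t $ j)) (\<lambda>s. \<Sum>i\<in>UNIV. b i * s $ i)"
proof
  fix s t z :: "int ^ 'n" and r :: int
  show "(\<Sum>i\<in>UNIV. \<Sum>j\<in>UNIV. A i j * ((s + t) $ i * z $ j)) =
      (\<Sum>i\<in>UNIV. \<Sum>j\<in>UNIV. A i j * (s $ i * z $ j)) + (\<Sum>i\<in>UNIV. \<Sum>j\<in>UNIV. A i j * (t $ i * z $ j))"
    by (simp add: algebra_simps sum.distrib)
  show "(\<Sum>i\<in>UNIV. \<Sum>j\<in>UNIV. A i j * ((r *s s) $ i * z $ j)) = r * (\<Sum>i\<in>UNIV. \<Sum>j\<in>UNIV. A i j * (s $ i * z $ j))"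
    by (simp add: sum_distrib_left mult_ac)
  show "(\<Sum>i\<in>UNIV. \<Sum>j\<in>UNIV. A i j * (s $ i * t $ j)) = (\<Sum>i\<in>UNIV. \<Sum>j\<in>UNIV. A i j * (t $ i * s $ j))"
    by (subst sum.swap, subst assms) (simp add: mult_ac)
  show "(\<Sum>i\<in>UNIV. b i * (s + t) $ i) = (\<Sum>i\<in>UNIV. b i * s $ i) + (\<Sum>i\<in>UNIV. b i * t $ i)"
    by (simp add: algebra_simps sum.distrib)
  show "(\<Sum>i\<in>UNIV. b i * (r *s s) $ i) = r * (\<Sum>i\<in>UNIV. b i * s $ i)"
    by (simp add: sum_distrib_left mult_ac)
qed

section \<open>Choice of the two directions\<close>

text \<open>Polarisation uses only the vectors \<open>axis i 1\<close> and
  \<open>axis i 1 + axis j 1\<close>, all with entries 0 and 1. So a symmetric form with a nonzero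
  matrix entry is nonzero at some such vector.\<close>

lemma symmetric_form_zero:
  fixes F :: "int ^ 'n::finite \<Rightarrow> int ^ 'n \<Rightarrow> int"
  assumes add: "\<And>x y z. F (x + y) z = F x z + F y z" and sym: "\<And>x y. F x y = F y x"
    and zero: "\<And>v. (\<And>i. v $ i \<in> {0, 1}) \<Longrightarrow> F v v = 0"
  shows "F (axis i 1) (axis j 1) = 0"
proof (cases "i = j")
  case True
  thus ?thesis by (auto intro!: zero simp: axis_def split: if_splits)
next
  case False
  have "F (axis i 1 + axis j 1) (axis i 1 + axis j 1) = 0"
    using False by (intro zero) (auto simp: axis_def)
  moreover have "F (axis i 1) (axis i 1) = 0" "F (axis j 1) (axis j 1) = 0"
    by (auto intro!: zero simp: axis_def split: if_splits)
  moreover have "F z (x + y) = F z x + F z y" for x y z using add sym by metis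
  ultimately show ?thesis by (simp add: add sym[of "axis j 1" "axis i 1"])
qed

text \<open>After \<open>u\<close>, the vector \<open>v\<close> comes from the symmetric form
  \<open>F x y = B u u * B x y - B u x * B u y\<close>, for which \<open>F v v = - gram u v\<close>.
  If \<open>F\<close> vanished, a nonzero multiple of the matrix of \<open>B\<close> would be the
  outer product of a vector with itself, which \<open>rank\<close> excludes.\<close>

lemma (in quadratic_map) gram_directions:
  assumes nz: "B (axis i0 1) (axis j0 1) \<noteq> 0"
    and rank: "\<And>a \<kappa>. a \<noteq> 0 \<Longrightarrow> \<exists>i j. a * B (axis i 1) (axis j 1) \<noteq> \<kappa> i * \<kappa> j"
  obtains u v where "\<And>i. u $ i \<in> {0, 1}" "\<And>i. v $ i \<in> {0, 1}" "B u u \<noteq> 0" "gram u v \<noteq> 0"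
proof -
  obtain u where u: "\<And>i. u $ i \<in> {0, 1}" "B u u \<noteq> 0"
    using symmetric_form_zero[of B, OF B_add B_sym] nz by blast
  define F where "F = (\<lambda>x y. B u u * B x y - B u x * B u y)"
  obtain i j where "F (axis i 1) (axis j 1) \<noteq> 0"
    using rank[OF u(2), of "\<lambda>i. B u (axis i 1)"] by (auto simp: F_def)
  moreover have "F (x + y) z = F x z + F y z" for x y z
    unfolding F_def expand by (simp add: algebra_simps)
  moreover have "F x y = F y x" for x y
    unfolding F_def B_sym[of y x] by (simp add: mult.commute)
  ultimately obtain v where v: "\<And>i. v $ i \<in> {0, 1}" "F v v \<noteq> 0"
    using symmetric_form_zero[of F] by blast
  hence "gram u v \<noteq> 0" by (simp add: F_def gram_def)
  thus ?thesis using that u v by blast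
qed

lemma rank_le_1:
  fixes M :: "rat ^ 'n::finite ^ 'm::finite"
  assumes "\<And>i j. M $ i $ j = \<alpha> i * \<kappa> j"
  shows "rank M \<le> 1"
proof -
  have "rows M \<subseteq> vec.span {\<chi> j. \<kappa> j}"
  proof
    fix r assume "r \<in> rows M"
    then obtain i where "r = row i M" by (auto simp: rows_def)
    hence "r = \<alpha> i *s (\<chi> j. \<kappa> j)" by (simp add: row_def assms vec_eq_iff)
    thus "r \<in> vec.span {\<chi> j. \<kappa> j}" by (auto simp: vec.span_singleton)
  qed
  hence "vec.dim (rows M) \<le> card {\<chi> j. \<kappa> j}" by (rule vec.dim_le_card) simp
  thus ?thesis by (simp add: row_rank_def_gen)
qed

text \<open>Put \<open>d = B u s + lin u\<close> and \<open>e = B v s + lin v\<close>. If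
  \<open>disc\<close> vanishes identically, multiplication by \<open>B u u\<close> gives \<open>B u
  u * (m * m) * Q s = (m * d)\<^sup>2 - (B u u * e - B u v * d)\<^sup>2\<close>, a difference of two
  squares, so \<open>q\<close> splits into linear factors over the rationals. Neither is a unit:
  along \<open>u\<close> each has slope a nonzero multiple of \<open>m * B u u\<close>, hence a
  rational zero.\<close>

lemma irreducible_disc_nonzero:
  fixes q :: "('n::finite, int) mpoly" and A :: "'n \<Rightarrow> 'n \<Rightarrow> int" and b :: "'n \<Rightarrow> int"
  assumes B_def: "B = (\<lambda>s t. \<Sum>i\<in>UNIV. \<Sum>j\<in>UNIV. A i j * (s $ i * t $ j))"
    and lin_def: "lin = (\<lambda>s. \<Sum>i\<in>UNIV. b i * s $ i)"
    and irred: "irreducible (rat_mpoly q)"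
    and A: "\<And>i j. A i j = A j i"
    and repr: "rat_mpoly q = quad_mpoly (\<lambda>i j. of_int (A i j) / 2) (\<lambda>i. of_int (b i)) (of_int c)"
    and a: "B u u \<noteq> 0" and gram: "quadratic_map.gram B u v \<noteq> 0"
    and square: "m * m = quadratic_map.gram B u v"
  shows "\<exists>s. quadratic_map.disc B lin (2 * c) u v s \<noteq> 0"
proof (rule ccontr)
  interpret quadratic_map B lin "2 * c"
    unfolding B_def lin_def by (rule quadratic_map_forms) (rule A)
  assume "\<nexists>s. disc u v s \<noteq> 0"
  hence disc0: "disc u v s = 0" for s by blast
  have m0: "m \<noteq> 0" using square gram by auto
  define \<kappa> where "\<kappa> = (\<lambda>u j. \<Sum>i\<in>UNIV. A i j * u $ i)"
  have B\<kappa>: "B u s = (\<Sum>j\<in>UNIV. \<kappa> u j * s $ j)" for u s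
    unfolding B_def \<kappa>_def by (subst sum.swap) (simp add: sum_distrib_left mult_ac)
  define f1 f2 where "f1 = (\<lambda>i. (m + B u v) * \<kappa> u i - B u u * \<kappa> v i)"
    and "f2 = (\<lambda>i. (m - B u v) * \<kappa> u i + B u u * \<kappa> v i)"
  define c1 c2 where "c1 = (m + B u v) * lin u - B u u * lin v"
    and "c2 = (m - B u v) * lin u + B u u * lin v"
  have comb: "(\<Sum>i\<in>UNIV. (x * \<kappa> u i + y * \<kappa> v i) * s $ i) = x * B u s + y * B v s" for x y s
    unfolding B\<kappa> by (simp add: distrib_right sum.distrib sum_distrib_left mult.assoc)
  have L1: "(\<Sum>i\<in>UNIV. f1 i * s $ i) = (m + B u v) * B u s - B u u * B v s" for s
    using comb[of "m + B u v" "- B u u" s] by (simp add: f1_def)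
  have L2: "(\<Sum>i\<in>UNIV. f2 i * s $ i) = (m - B u v) * B u s + B u u * B v s" for s
    unfolding f2_def by (rule comb)
  have factor: "B u u * (m * m) * Q s = ((\<Sum>i\<in>UNIV. f1 i * s $ i) + c1) * ((\<Sum>i\<in>UNIV. f2 i * s $ i) + c2)" for s
  proof -
    define d e where "d = B u s + lin u" and "e = B v s + lin v"
    have 1: "(\<Sum>i\<in>UNIV. f1 i * s $ i) + c1 = (m + B u v) * d - B u u * e"
      unfolding L1 c1_def d_def e_def by algebra
    have 2: "(\<Sum>i\<in>UNIV. f2 i * s $ i) + c2 = (m - B u v) * d + B u u * e"
      unfolding L2 c2_def d_def e_def by algebra
    have "2 * B u v * d * e - B u u * e * e - B v v * d * d - m * m * Q s = 0"
      using disc0[of s] unfolding disc_def square[symmetric] d_def e_def .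
    moreover have "m * m = B u v * B u v - B u u * B v v" using square by (simp add: gram_def)
    ultimately show ?thesis unfolding 1 2 by algebra
  qed
  \<comment> \<open>The 2 reflects \<open>Q = 2 * q\<close> at integer points. The scalar is
    absorbed into \<open>P2\<close>.\<close>
  define r :: rat where "r = 1 / of_int (2 * B u u * (m * m))"
  define P1 :: "('n, rat) mpoly" where "P1 = lin_mpoly (\<lambda>i. of_int (f1 i)) (of_int c1)"
  define P2 :: "('n, rat) mpoly" where "P2 = lin_mpoly (\<lambda>i. r * of_int (f2 i)) (r * of_int c2)"
  \<comment> \<open>With \<open>x = 1\<close> this is evaluation at integer points; other rational
    \<open>x\<close> give the zeros on the line through \<open>u\<close>.\<close>
  have e1: "eval_mpoly P1 (\<chi> i. x * of_int (s $ i)) = x * of_int (\<Sum>i\<in>UNIV. f1 i * s $ i) + of_int c1" for x s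
    by (simp add: P1_def eval_lin_mpoly sum_distrib_left mult_ac)
  have e2: "eval_mpoly P2 (\<chi> i. x * of_int (s $ i)) = r * (x * of_int (\<Sum>i\<in>UNIV. f2 i * s $ i) + of_int c2)" for x s
    by (simp add: P2_def eval_lin_mpoly sum_distrib_left distrib_left mult_ac)
  have evq: "of_int (Q s) = 2 * eval_mpoly (rat_mpoly q) (\<chi> i. of_int (s $ i))" for s
    unfolding repr eval_quad_mpoly Q_def unfolding B_def lin_def
    by (simp add: sum_distrib_left mult_ac distrib_left)
  have "rat_mpoly q - P1 * P2 = 0"
  proof -
    have eval0: "eval_mpoly (rat_mpoly q - P1 * P2) (\<chi> i. of_int (s $ i)) = 0" for s :: "int ^ 'n"
    proof -
      have "eval_mpoly (rat_mpoly q) (\<chi> i. of_int (s $ i)) =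
          eval_mpoly (rat_mpoly q - P1 * P2) (\<chi> i. of_int (s $ i)) + eval_mpoly (P1 * P2) (\<chi> i. of_int (s $ i))"
        by (simp flip: eval_mpoly_add)
      moreover have "eval_mpoly (P1 * P2) (\<chi> i. of_int (s $ i)) = eval_mpoly (rat_mpoly q) (\<chi> i. of_int (s $ i))"
      proof -
        have "eval_mpoly (P1 * P2) (\<chi> i. of_int (s $ i)) =
            r * of_int (((\<Sum>i\<in>UNIV. f1 i * s $ i) + c1) * ((\<Sum>i\<in>UNIV. f2 i * s $ i) + c2))"
          using e1[of 1 s] e2[of 1 s] by (simp add: eval_mpoly_mult)
        also have "\<dots> = r * (of_int (B u u * (m * m)) * of_int (Q s))"
          unfolding factor[symmetric] by simp
        also have "\<dots> = eval_mpoly (rat_mpoly q) (\<chi> i. of_int (s $ i))"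
          unfolding evq r_def using a m0 by simp
        finally show ?thesis .
      qed
      ultimately show ?thesis by simp
    qed
    thus ?thesis
      unfolding repr P1_def P2_def lin_mpoly_mult quad_mpoly_diff by (rule quad_mpoly_eq_0)
  qed
  hence "rat_mpoly q = P1 * P2" by simp
  moreover have "\<not> P1 dvd 1"
  proof (rule not_dvd_one_if_root)
    have "(\<Sum>i\<in>UNIV. f1 i * u $ i) = m * B u u"
      unfolding L1 B_sym[of v u] by algebra
    thus "eval_mpoly P1 (\<chi> i. (- of_int c1 / of_int (m * B u u)) * of_int (u $ i)) = 0"
      unfolding e1 using a m0 by simp
  qed
  moreover have "\<not> P2 dvd 1"
  proof (rule not_dvd_one_if_root)
    have "(\<Sum>i\<in>UNIV. f2 i * u $ i) = m * B u u"
      unfolding L2 B_sym[of v u] by algebra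
    thus "eval_mpoly P2 (\<chi> i. (- of_int c2 / of_int (m * B u u)) * of_int (u $ i)) = 0"
      unfolding e2 using a m0 by simp
  qed
  ultimately show False using irred by (metis irreducible_def)
qed

section \<open>The bound for \<open>q\<close>\<close>

lemma integer_quadric_bound:
  fixes \<epsilon> :: real
  assumes "CARD('n::finite) \<ge> 2" and "\<epsilon> > 0"
  shows "\<exists>C::real. C > 0 \<and>
    (\<forall>q :: ('n, int) mpoly.
       total_degree q = 2 \<longrightarrow>
       irreducible (rat_mpoly q) \<longrightarrow>
       form_rank (quadratic_part (rat_mpoly q)) \<ge> 2 \<longrightarrow>
       (\<forall>N::int. N \<ge> 1 \<longrightarrow>
          real (card {t :: int ^ 'n. (\<forall>i. \<bar>t $ i\<bar> \<le> N) \<and> eval_mpoly q t = 0})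
            \<le> C * real_of_int N powr (real CARD('n) - 2 + \<epsilon>)))"
proof -
  obtain C0 where C0: "C0 \<ge> 1" "\<And>a b c d e g N :: int. b * b - a * c \<noteq> 0 \<Longrightarrow>
    2 * b * d * e - a * e * e - c * d * d - (b * b - a * c) * g \<noteq> 0 \<Longrightarrow> N \<ge> 1 \<Longrightarrow>
    real (card {(x, y). a * x * x + 2 * b * x * y + c * y * y + 2 * d * x + 2 * e * y + g = 0 \<and> \<bar>x\<bar> \<le> N \<and> \<bar>y\<bar> \<le> N})
      \<le> C0 * real_of_int N powr \<epsilon>"
    using conic_bound[OF assms(2)] by blast
  define n where "n = CARD('n)"
  \<comment> \<open>The slices carry conics in a box of side parameter \<open>2 * N\<close>, whence
    \<open>2 powr \<epsilon>\<close>.\<close>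
  define C1 where "C1 = C0 * 2 powr \<epsilon> + 1 + 4 * real n"
  have C1: "C1 > 0" using C0(1) by (simp add: C1_def add_nonneg_pos add_pos_nonneg)
  have bound: "real (card {t :: int ^ 'n. (\<forall>i. \<bar>t $ i\<bar> \<le> N) \<and> eval_mpoly q t = 0})
      \<le> (11 ^ (n - 2) * C1) * real_of_int N powr (real n - 2 + \<epsilon>)"
    if deg: "total_degree q = 2" and irred: "irreducible (rat_mpoly q)"
      and rank: "form_rank (quadratic_part (rat_mpoly q)) \<ge> 2" and N: "N \<ge> 1"
    for q :: "('n, int) mpoly" and N :: int
  proof -
    \<comment> \<open>Twice the symmetric matrix of the quadratic part, which is integral.\<close>
    define A where "A = (\<lambda>i j. if i = j then 2 * Poly_Mapping.lookup q (Poly_Mapping.single i 2)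
      else Poly_Mapping.lookup q (var i + var j))"
    define b where "b = (\<lambda>i. Poly_Mapping.lookup q (var i))"
    define c where "c = Poly_Mapping.lookup q 0"
    define M where "M = form_matrix (quadratic_part (rat_mpoly q))"
    have Asym: "A i j = A j i" for i j by (simp add: A_def add.commute)
    have MA: "M $ i $ j = of_int (A i j) / 2" for i j
      by (simp add: M_def A_def form_matrix_quadratic_part lookup_rat_mpoly del: One_nat_def)
    have repr: "rat_mpoly q = quad_mpoly (\<lambda>i j. of_int (A i j) / 2) (\<lambda>i. of_int (b i)) (of_int c)"
      using quad_mpoly_repr[of "rat_mpoly q"] deg
      unfolding MA[symmetric] by (simp add: M_def b_def c_def lookup_rat_mpoly total_degree_rat_mpoly del: One_nat_def)
    define B where "B = (\<lambda>s t :: int ^ 'n. \<Sum>i\<in>UNIV. \<Sum>j\<in>UNIV. A i j * (s $ i * t $ j))"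
    define lin where "lin = (\<lambda>s :: int ^ 'n. \<Sum>i\<in>UNIV. b i * s $ i)"
    interpret quadratic_map B lin "2 * c"
      unfolding B_def lin_def by (rule quadratic_map_forms) (rule Asym)
    have Bax: "B (axis i 1) (axis j 1) = A i j" for i j
      unfolding B_def double_sum_axis by simp
    have rk: "\<not> (\<forall>i j. M $ i $ j = \<alpha> i * \<kappa> j)" for \<alpha> \<kappa>
      using rank_le_1[of M \<alpha> \<kappa>] rank by (auto simp: form_rank_def M_def)
    \<comment> \<open>The zero matrix is an outer product too, so the rank condition already yields
      a nonzero entry.\<close>
    obtain i0 j0 where "A i0 j0 \<noteq> 0" using rk[of "\<lambda>_. 0" "\<lambda>_. 0"] MA by auto
    hence nz: "B (axis i0 1) (axis j0 1) \<noteq> 0" by (simp add: Bax)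
    have "\<exists>i j. a * B (axis i 1) (axis j 1) \<noteq> \<kappa> i * \<kappa> j" if "a \<noteq> 0" for a \<kappa>
    proof (rule ccontr)
      assume "\<nexists>i j. a * B (axis i 1) (axis j 1) \<noteq> \<kappa> i * \<kappa> j"
      hence "a * A i j = \<kappa> i * \<kappa> j" for i j by (simp add: Bax)
      hence "of_int a * of_int (A i j) = (of_int (\<kappa> i) * of_int (\<kappa> j) :: rat)" for i j
        by (metis of_int_mult)
      hence "M $ i $ j = (of_int (\<kappa> i) / (2 * of_int a)) * of_int (\<kappa> j)" for i j
        using that unfolding MA by (simp add: field_simps)
      thus False using rk[of "\<lambda>i. of_int (\<kappa> i) / (2 * of_int a)" "\<lambda>j. of_int (\<kappa> j)"] by blast
    qed
    then obtain u v where uv: "\<And>i. u $ i \<in> {0, 1}" "\<And>i. v $ i \<in> {0, 1}" "B u u \<noteq> 0" "gram u v \<noteq> 0"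
      using gram_directions[OF nz] by metis
    have Qq: "Q t = 2 * eval_mpoly q t" for t
    proof -
      have "of_int (Q t) = 2 * eval_mpoly (rat_mpoly q) (\<chi> i. of_int (t $ i))"
        unfolding repr eval_quad_mpoly Q_def unfolding B_def lin_def
        by (simp add: sum_distrib_left mult_ac distrib_left)
      also have "\<dots> = of_int (2 * eval_mpoly q t)" by (simp add: eval_rat_mpoly)
      finally show ?thesis by (simp only: of_int_eq_iff)
    qed
    have N2: "1 \<le> 2 * N" using N by simp
    have "real (card {t. (\<forall>i. \<bar>t $ i\<bar> \<le> N) \<and> Q t = 0})
        \<le> real_of_int (10 * N + 1) ^ (CARD('n) - 2) * (C0 * real_of_int (2 * N) powr \<epsilon> + 1 + 4 * real CARD('n))"
    proof (rule zeros_card_le[OF uv])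
      show "\<exists>s. disc u v s \<noteq> 0" if "m * m = gram u v" for m
        using irreducible_disc_nonzero[OF B_def lin_def irred Asym repr uv(3,4) that] .
    qed (rule N, erule (1) C0(2)[OF _ _ N2])
    also have "\<dots> \<le> (11 * real_of_int N) ^ (n - 2) * (C1 * real_of_int N powr \<epsilon>)"
    proof (rule mult_mono)
      have "real_of_int (10 * N + 1) \<le> 11 * real_of_int N" using N by simp
      thus "real_of_int (10 * N + 1) ^ (CARD('n) - 2) \<le> (11 * real_of_int N) ^ (n - 2)"
        unfolding n_def using N by (intro power_mono) auto
      have "1 \<le> real_of_int N powr \<epsilon>" using N assms(2) by (intro ge_one_powr_ge_zero) auto
      hence "(1 + 4 * real n) * 1 \<le> (1 + 4 * real n) * real_of_int N powr \<epsilon>" by (intro mult_left_mono) auto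
      moreover have "real_of_int (2 * N) powr \<epsilon> = 2 powr \<epsilon> * real_of_int N powr \<epsilon>" using N by (simp add: powr_mult)
      ultimately show "C0 * real_of_int (2 * N) powr \<epsilon> + 1 + 4 * real CARD('n) \<le> C1 * real_of_int N powr \<epsilon>"
        by (simp add: C1_def n_def algebra_simps)
    qed (use N C0(1) in auto)
    also have "\<dots> = (11 ^ (n - 2) * C1) * (real_of_int N ^ (n - 2) * real_of_int N powr \<epsilon>)"
      by (simp add: power_mult_distrib mult_ac)
    also have "real_of_int N ^ (n - 2) * real_of_int N powr \<epsilon> = real_of_int N powr (real n - 2 + \<epsilon>)"
    proof -
      have "real_of_int N ^ (n - 2) = real_of_int N powr real (n - 2)" using N by (simp add: powr_realpow)
      also have "real (n - 2) = real n - 2" using assms(1) by (simp add: n_def of_nat_diff)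
      finally show ?thesis by (simp add: powr_add)
    qed
    finally show ?thesis by (simp add: Qq)
  qed
  have "11 ^ (n - 2) * C1 > 0" using C1 by simp
  thus ?thesis using bound unfolding n_def by blast
qed

theorem theorem1p11:
  fixes \<epsilon> :: real
  assumes "CARD('n::finite) \<ge> 2" and "\<epsilon> > 0"
  shows "\<exists>C::real. C > 0 \<and>
    (\<forall>q :: ('n, int) mpoly.
       total_degree q = 2 \<longrightarrow>
       irreducible (rat_mpoly q) \<longrightarrow>
       form_rank (quadratic_part (rat_mpoly q)) \<ge> 2 \<longrightarrow>
       (\<forall>B::real. B \<ge> 1 \<longrightarrow>
          real (card {t :: int ^ 'n. real_of_int (sup_norm t) \<le> B \<and> eval_mpoly q t = 0})
            \<le> C * B powr (real CARD('n) - 2 + \<epsilon>)))"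
proof -
  obtain C :: real where C: "C > 0" and bound: "\<And>(q :: ('n, int) mpoly) (N :: int). total_degree q = 2 \<Longrightarrow>
      irreducible (rat_mpoly q) \<Longrightarrow> form_rank (quadratic_part (rat_mpoly q)) \<ge> 2 \<Longrightarrow> N \<ge> 1 \<Longrightarrow>
      real (card {t :: int ^ 'n. (\<forall>i. \<bar>t $ i\<bar> \<le> N) \<and> eval_mpoly q t = 0})
        \<le> C * real_of_int N powr (real CARD('n) - 2 + \<epsilon>)"
    using integer_quadric_bound[OF assms] by blast
  have "real (card {t :: int ^ 'n. real_of_int (sup_norm t) \<le> B \<and> eval_mpoly q t = 0})
      \<le> C * B powr (real CARD('n) - 2 + \<epsilon>)"
    if q: "total_degree q = 2" "irreducible (rat_mpoly q)" "form_rank (quadratic_part (rat_mpoly q)) \<ge> 2"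
      and B: "B \<ge> 1" for q :: "('n, int) mpoly" and B
  proof -
    \<comment> \<open>The coordinates are integers, so \<open>B\<close> may be rounded down. The
      exponent is nonnegative, so the bound at the floor is at most the bound at
      \<open>B\<close>.\<close>
    have "real_of_int (sup_norm t) \<le> B \<longleftrightarrow> (\<forall>i. \<bar>t $ i\<bar> \<le> \<lfloor>B\<rfloor>)" for t :: "int ^ 'n"
      unfolding sup_norm_def le_floor_iff[symmetric] by (subst Max_le_iff) auto
    hence "real (card {t :: int ^ 'n. real_of_int (sup_norm t) \<le> B \<and> eval_mpoly q t = 0}) =
        real (card {t :: int ^ 'n. (\<forall>i. \<bar>t $ i\<bar> \<le> \<lfloor>B\<rfloor>) \<and> eval_mpoly q t = 0})" by simp
    also have "\<dots> \<le> C * real_of_int \<lfloor>B\<rfloor> powr (real CARD('n) - 2 + \<epsilon>)"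
      using B by (intro bound q) linarith
    also have "\<dots> \<le> C * B powr (real CARD('n) - 2 + \<epsilon>)"
      using C B assms by (intro mult_left_mono powr_mono2) auto
    finally show ?thesis .
  qed
  thus ?thesis using C by blast
qed

end
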